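(* Let $a_h$ and $a_h^+$ be uniformly coercive and continuous bilinear forms on $\mathcal{V}\times\mathcal{V}$. Suppose there is a constant $\eta\in[2,\infty]$ such that the following three conditions hold: (i) For every $h\le h_0$, $\mathcal{V}_h,\mathcal{V}_h^+\subset W^{s,\eta}(\Omega)\cap\mathcal{V}$. (ii) There exists $C>0$ independent of $h$ such that $\|w_h\|_{m,\eta}\le Ch^{-m}\|w_h\|_{0,\eta}$ for every $m=0,1,\dots,s$, every $w_h\in\mathcal{V}_h^+\cap\mathcal{V}_h$, and every $h\le h_0$. (iii) There exist constants $\gamma\ge0$ and $C>0$ independent of $h$ and a map $\pi_h:\mathcal{V}_h^++\mathcal{V}_h\to\mathcal{V}_h^+\cap\mathcal{V}_h$ such that $\|\pi_hw_h\|_{0,\eta}\le C\|w_h\|_{0,\eta}$ and $|\mathrm{supp}(\pi_hw_h-w_h)|\le Ch^\gamma$ for every $w_h\in\mathcal{V}_h^++\mathcal{V}_h$ and every $h\le h_0$. Suppose further that there exist constants $C_1>0$, $\delta\ge0$, $1\le q\le\eta$, and $\mu,\nu\in\{0,1,\dots,s\}$ independent of $h$ such that $$|a_h^+(v,w)-a_h(v,w)|\le C_1h^\delta\|v\|_{\mu,\eta}\|w\|_{\nu,q}$$ for every $v,w\in W^{s,\eta}(\Omega)\cap\mathcal{V}$ and every $h\le h_0$. Finally, suppose that for some integer $r>s$, and with $\ell(h)$ either identically unity or equal to $\log(h^{-1})$, the projectors $r_h$ and $r_h^+$ satisfy, with $C$ independent of $h$, $$\|r_hu-u\|_{0,\eta}+\|r_h^+u-u\|_{0,\eta}\le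 C\ell(h)h^r|u|_{r,\eta},$$ $$\|r_hu-u\|_{m,\eta}+\|r_h^+u-u\|_{m,\eta}\le Ch^{r-m}|u|_{r,\eta},\quad m=1,2,\dots,s,$$ for every $u\in W^{r,\eta}(\Omega)\cap\mathcal{V}$ and every $h\le h_0$ (the second estimate being vacuous if $s=0$). Then there exists $C>0$ independent of $h$ such that $$\|r_h^+u-r_hu\|_{s,2}\le C\ell(h)h^{r-s+\sigma}|u|_{r,\eta}$$ for every $u\in W^{r,\eta}(\Omega)\cap\mathcal{V}$ and every $h\le h_0$, with $$\sigma=\min\left\{\gamma\left(\frac12-\frac1\eta\right),\frac{\delta+2s-\mu-\nu}{2}\right\}.$$ In particular, if $a_h=a_h^+$, then $$\|r_h^+u-r_hu\|_{s,2}\le C\ell(h)h^{r-s+\gamma(1/2-1/\eta)}|u|_{r,\eta}$$ for every $u\in W^{r,\eta}(\Omega)\cap\mathcal{V}$ and every $h\le h_0$.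
   Context: Let $s\ge 0$ be an integer, $\Omega\subset\mathbb{R}^d$ ($d \ge 1$) an open, bounded, Lipschitz domain, and $\mathcal{V}$ a closed subspace of $H^s(\Omega)=W^{s,2}(\Omega)$ (with $H^0=L^2$). $\|\cdot\|_{s,p}$ and $|\cdot|_{s,p}$ denote the norm and semi-norm of the Sobolev space $W^{s,p}(\Omega)$ (with $W^{0,p}=L^p$), and $|E|$ denotes the Lebesgue measure of a set $E$. Let $h_0$ be a positive scalar. For each $0<h\le h_0$, $a_h,a_h^+:\mathcal{V}\times\mathcal{V}\to\mathbb{R}$ are bilinear forms that may depend on $h$. "Uniformly coercive and continuous" means there are constants $\alpha>0$ and $M>0$ independent of $h$ such that $a_h(u,u)\ge\alpha\|u\|_{s,2}^2$ and $a_h(u,w)\le M\|u\|_{s,2}\|w\|_{s,2}$ for all $u,w\in\mathcal{V}$ and all $h\le h_0$, and the same inequalities hold for $a_h^+$ with the same constants. Let $\{\mathcal{V}_h\}_{0<h\le h_0}$ and $\{\mathcal{V}_h^+\}_{0<h\le h_0}$ be two families of finite element (finite-dimensional) subspaces of $\mathcal{V}$. The linear projectors $r_h:\mathcal{V}\to\mathcal{V}_h$ and $r_h^+:\mathcal{V}\to\mathcal{V}_h^+$ are defined (uniquely, by Lax-Milgram) by $a_h(r_hu-u,w_h)=0$ for all $w_h\in\mathcal{V}_h$, and $a_h^+(r_h^+u-u,w_h^+)=0$ for all $w_h^+\in\mathcal{V}_h^+$. The letter $C$ denotes a constant independent of $h$, not necessarily the same at each occurrence (and, where a bound is asserted for every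 function in a class, independent of that function). The convention $1/\infty=0$ is used.
   Formalization: When ℓ(h) = log(1/h), the formal theorem additionally requires h₀ < 1; the claim fails for h₀ = 1, where the logarithm vanishes as h → 1, and for h₀ > 1 the L^η error estimate forces |u|_{r,η} = 0. *)

theory Defs
  imports
    "HOL-Analysis.Analysis"
    "HOL-Probability.Essential_Supremum"
    "HOL-Library.Function_Algebras"
    "HOL-Library.Set_Algebras"
begin

text \<open>
  Elements of Lebesgue and Sobolev spaces over a domain are represented by functions on the whole
  space of which only the values on the domain, up to null sets, matter. A subspace of such a space
  is accordingly a set of functions that is closed under equality almost everywhere on the domain.
\<close>

instantiation "fun" :: (type, real_vector) real_vector
begin

definition scaleR_fun :: "real \<Rightarrow> ('a \<Rightarrow> 'b) \<Rightarrow> 'a \<Rightarrow> 'b"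
  where "scaleR_fun c f = (\<lambda>x. c *\<^sub>R f x)"

instance
  by standard (auto simp: scaleR_fun_def fun_eq_iff scaleR_add_right scaleR_add_left)

end


subsection \<open>Lipschitz domains\<close>

text \<open>
  Near each boundary point, and after a rotation that turns the unit vector \<open>e\<close> into a coordinate
  direction, the set is the part of a ball below the graph of a Lipschitz function \<open>g\<close> of the
  remaining coordinates. Connectedness is not required.
\<close>

definition lipschitz_domain :: "(real^'d) set \<Rightarrow> bool" where
  "lipschitz_domain \<Omega> \<longleftrightarrow> open \<Omega> \<and> \<Omega> \<noteq> {} \<and>
     (\<forall>x\<in>frontier \<Omega>. \<exists>\<rho>>0. \<exists>e L. \<exists>g :: real^'d \<Rightarrow> real.
        norm e = 1 \<and> L-lipschitz_on {z. z \<bullet> e = 0} g \<and>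
        \<Omega> \<inter> ball x \<rho> = {y \<in> ball x \<rho>. y \<bullet> e < g (y - (y \<bullet> e) *\<^sub>R e)})"


subsection \<open>Lebesgue spaces with exponent in \<open>[1,\<infinity>]\<close>\<close>

definition Lp_space :: "(real^'d) set \<Rightarrow> ennreal \<Rightarrow> (real^'d \<Rightarrow> real) set" where
  "Lp_space \<Omega> p = {f \<in> borel_measurable (lebesgue_on \<Omega>).
     if p = \<infinity> then esssup (lebesgue_on \<Omega>) (\<lambda>x. ennreal \<bar>f x\<bar>) < \<infinity>
     else integrable (lebesgue_on \<Omega>) (\<lambda>x. \<bar>f x\<bar> powr enn2real p)}"

definition Lp_norm :: "(real^'d) set \<Rightarrow> ennreal \<Rightarrow> (real^'d \<Rightarrow> real) \<Rightarrow> real" where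
  "Lp_norm \<Omega> p f =
     (if p = \<infinity> then enn2real (esssup (lebesgue_on \<Omega>) (\<lambda>x. ennreal \<bar>f x\<bar>))
      else (\<integral>x. \<bar>f x\<bar> powr enn2real p \<partial>lebesgue_on \<Omega>) powr (1 / enn2real p))"


subsection \<open>Weak derivatives\<close>

definition partial_deriv :: "'d \<Rightarrow> (real^'d \<Rightarrow> real) \<Rightarrow> real^'d \<Rightarrow> real" where
  "partial_deriv i f x = frechet_derivative f (at x) (axis i 1)"

definition smooth :: "(real^'d \<Rightarrow> real) \<Rightarrow> bool" where
  "smooth f \<longleftrightarrow> (\<forall>is x. foldr partial_deriv is f differentiable at x)"

definition test_functions :: "(real^'d) set \<Rightarrow> (real^'d \<Rightarrow> real) set" where
  "test_functions \<Omega> =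
     {\<phi>. smooth \<phi> \<and> compact (closure {x. \<phi> x \<noteq> 0}) \<and> closure {x. \<phi> x \<noteq> 0} \<subseteq> \<Omega>}"

text \<open>
  A multi-index is a function \<open>\<alpha>\<close> from coordinates to naturals. The order in which the coordinates
  are differentiated is chosen arbitrarily; it is immaterial for smooth functions.
\<close>

abbreviation mi_order :: "('d::finite \<Rightarrow> nat) \<Rightarrow> nat" where
  "mi_order \<alpha> \<equiv> sum \<alpha> UNIV"

definition multi_deriv :: "('d \<Rightarrow> nat) \<Rightarrow> (real^'d \<Rightarrow> real) \<Rightarrow> real^'d \<Rightarrow> real" where
  "multi_deriv \<alpha> f = foldr partial_deriv (SOME is. \<forall>i. count_list is i = \<alpha> i) f"

definition locally_integrable :: "(real^'d) set \<Rightarrow> (real^'d \<Rightarrow> real) \<Rightarrow> bool" where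
  "locally_integrable \<Omega> f \<longleftrightarrow> (\<forall>K. compact K \<and> K \<subseteq> \<Omega> \<longrightarrow> f absolutely_integrable_on K)"

definition has_weak_deriv ::
    "(real^'d) set \<Rightarrow> ('d \<Rightarrow> nat) \<Rightarrow> (real^'d \<Rightarrow> real) \<Rightarrow> (real^'d \<Rightarrow> real) \<Rightarrow> bool" where
  "has_weak_deriv \<Omega> \<alpha> f g \<longleftrightarrow> locally_integrable \<Omega> f \<and> locally_integrable \<Omega> g \<and>
     (\<forall>\<phi>\<in>test_functions \<Omega>.
        (\<integral>x. f x * multi_deriv \<alpha> \<phi> x \<partial>lebesgue_on \<Omega>) =
        (-1) ^ mi_order \<alpha> * (\<integral>x. g x * \<phi> x \<partial>lebesgue_on \<Omega>))"

text \<open>A representative of the weak derivative, which is unique almost everywhere.\<close>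

definition weak_deriv :: "(real^'d) set \<Rightarrow> ('d \<Rightarrow> nat) \<Rightarrow> (real^'d \<Rightarrow> real) \<Rightarrow> real^'d \<Rightarrow> real" where
  "weak_deriv \<Omega> \<alpha> f = (SOME g. has_weak_deriv \<Omega> \<alpha> f g)"


subsection \<open>Sobolev spaces\<close>

definition sobolev_space :: "(real^'d) set \<Rightarrow> nat \<Rightarrow> ennreal \<Rightarrow> (real^'d \<Rightarrow> real) set" where
  "sobolev_space \<Omega> m p = {f \<in> Lp_space \<Omega> p.
     \<forall>\<alpha>. mi_order \<alpha> \<le> m \<longrightarrow> (\<exists>g\<in>Lp_space \<Omega> p. has_weak_deriv \<Omega> \<alpha> f g)}"

definition sobolev_norm_over ::
    "('d \<Rightarrow> nat) set \<Rightarrow> (real^'d) set \<Rightarrow> ennreal \<Rightarrow> (real^'d \<Rightarrow> real) \<Rightarrow> real" where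
  "sobolev_norm_over A \<Omega> p f =
     (if p = \<infinity> then (MAX \<alpha>\<in>A. Lp_norm \<Omega> p (weak_deriv \<Omega> \<alpha> f))
      else (\<Sum>\<alpha>\<in>A. Lp_norm \<Omega> p (weak_deriv \<Omega> \<alpha> f) powr enn2real p) powr (1 / enn2real p))"

definition sobolev_norm :: "(real^'d) set \<Rightarrow> nat \<Rightarrow> ennreal \<Rightarrow> (real^'d \<Rightarrow> real) \<Rightarrow> real" where
  "sobolev_norm \<Omega> m p f = sobolev_norm_over {\<alpha>. mi_order \<alpha> \<le> m} \<Omega> p f"

definition sobolev_seminorm :: "(real^'d) set \<Rightarrow> nat \<Rightarrow> ennreal \<Rightarrow> (real^'d \<Rightarrow> real) \<Rightarrow> real" where
  "sobolev_seminorm \<Omega> m p f = sobolev_norm_over {\<alpha>. mi_order \<alpha> = m} \<Omega> p f"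

text \<open>Closedness already forces a subspace to be closed under equality almost everywhere on \<open>\<Omega>\<close>.\<close>

definition closed_sobolev_subspace ::
    "(real^'d) set \<Rightarrow> nat \<Rightarrow> (real^'d \<Rightarrow> real) set \<Rightarrow> bool" where
  "closed_sobolev_subspace \<Omega> s V \<longleftrightarrow> subspace V \<and> V \<subseteq> sobolev_space \<Omega> s 2 \<and>
     (\<forall>f v. range f \<subseteq> V \<and> v \<in> sobolev_space \<Omega> s 2 \<and>
        (\<lambda>n::nat. sobolev_norm \<Omega> s 2 (f n - v)) \<longlonglongrightarrow> 0 \<longrightarrow> v \<in> V)"

definition finite_dim_subspace ::
    "(real^'d) set \<Rightarrow> (real^'d \<Rightarrow> real) set \<Rightarrow> (real^'d \<Rightarrow> real) set \<Rightarrow> bool" where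
  "finite_dim_subspace \<Omega> V W \<longleftrightarrow> subspace W \<and> W \<subseteq> V \<and>
     (\<forall>v\<in>V. \<forall>w\<in>W. (AE x in lebesgue_on \<Omega>. v x = w x) \<longrightarrow> v \<in> W) \<and>
     (\<exists>B. finite B \<and> B \<subseteq> W \<and> (\<forall>w\<in>W. \<exists>b\<in>span B. AE x in lebesgue_on \<Omega>. w x = b x))"

text \<open>
  The support of a class of functions: the complement in \<open>\<Omega>\<close> of the largest open set on which the
  function vanishes almost everywhere.
\<close>

definition ess_support :: "(real^'d) set \<Rightarrow> (real^'d \<Rightarrow> real) \<Rightarrow> (real^'d) set" where
  "ess_support \<Omega> f = \<Omega> - \<Union>{U. open U \<and> U \<subseteq> \<Omega> \<and> (AE x in lebesgue_on U. f x = 0)}"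


subsection \<open>Bilinear forms and their projectors\<close>

definition bilinear_form_on ::
    "'a::real_vector set \<Rightarrow> ('a \<Rightarrow> 'a \<Rightarrow> real) \<Rightarrow> bool" where
  "bilinear_form_on V b \<longleftrightarrow> (\<forall>u\<in>V. \<forall>v\<in>V. \<forall>w\<in>V. \<forall>c.
     b (u + v) w = b u w + b v w \<and> b (c *\<^sub>R u) w = c * b u w \<and>
     b w (u + v) = b w u + b w v \<and> b w (c *\<^sub>R u) = c * b w u)"

definition coercive_continuous ::
    "(real^'d) set \<Rightarrow> nat \<Rightarrow> (real^'d \<Rightarrow> real) set \<Rightarrow> real \<Rightarrow> real \<Rightarrow>
     ((real^'d \<Rightarrow> real) \<Rightarrow> (real^'d \<Rightarrow> real) \<Rightarrow> real) \<Rightarrow> bool" where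
  "coercive_continuous \<Omega> s V \<kappa> M b \<longleftrightarrow>
     (\<forall>u\<in>V. \<kappa> * (sobolev_norm \<Omega> s 2 u)\<^sup>2 \<le> b u u) \<and>
     (\<forall>u\<in>V. \<forall>w\<in>V. b u w \<le> M * sobolev_norm \<Omega> s 2 u * sobolev_norm \<Omega> s 2 w)"

text \<open>
  For a coercive continuous form and a finite-dimensional \<open>W\<close>, such an \<open>r\<close> exists and is unique, hence
  linear, up to equality almost everywhere.
\<close>

definition is_projector ::
    "'a::real_vector set \<Rightarrow> 'a set \<Rightarrow> ('a \<Rightarrow> 'a \<Rightarrow> real) \<Rightarrow> ('a \<Rightarrow> 'a) \<Rightarrow> bool" where
  "is_projector V W b r \<longleftrightarrow> (\<forall>u\<in>V. r u \<in> W \<and> (\<forall>w\<in>W. b (r u - u) w = 0))"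

end

theory Submission
  imports Defs
begin

text \<open>
  Let \<open>e\<close> be the difference of the two projections of \<open>u\<close> and \<open>w = \<pi>\<^sub>h e\<close>. By coercivity, the square of
  the norm of \<open>e\<close> is controlled by \<open>a\<^sub>h\<^sup>+(e, e - w) + a\<^sub>h\<^sup>+(e, w)\<close>. In the first term, \<open>e - w\<close> lives on a set of
  measure \<open>O(h\<^sup>\<gamma>)\<close>, so Hoelder's inequality trades integrability \<open>\<eta>\<close> for the factor
  \<open>h\<close> to the power \<open>\<gamma>(1/2 - 1/\<eta>)\<close>. In the second, \<open>w\<close> is an admissible test function in both Galerkin
  problems, so only the difference of the two forms survives.

  Since norms are defined through representatives of weak derivatives, linearity and locality of
  the norms rest on the uniqueness of weak derivatives, that is, on the fundamental lemma of the
  calculus of variations. Constants in the triangle inequalities are immaterial, so crude ones suffice.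
\<close>


subsection \<open>Test functions approximating boxes\<close>

text \<open>The two exponents in the minimum enter differently. The support term is multiplied by
  the norm of \<open>e\<close>, one power of which cancels against the square on the left, so its
  exponent counts in full. The consistency term is h^\<delta> times a product of factors of orders
  h^(r-\<mu>) and h^(r-\<nu>), with no factor to cancel; a square root is taken, and this is the
  origin of the half in the second entry of the minimum. The map \<open>\<pi>h\<close> is stable
  only in the norm of order 0. Norms of \<open>w\<close> of order m are therefore recovered from the
  L^\<eta> bound of \<open>e\<close> by the inverse estimate, whose loss h^(-m) is exactly the loss
  of rate that the projection errors have at order m. The support condition concerns values only,
  while the norms contain derivatives up to order s. The link is that weak derivatives vanish almost
  everywhere on open sets where the function does.\<close>

definition flat :: "nat \<Rightarrow> real \<Rightarrow> real" where
  "flat k t = (if t > 0 then (1 / t) ^ k * exp (- (1 / t)) else 0)"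

text \<open>This is the difference quotient of \<open>flat k\<close> at the origin, the only point
  where differentiability is in doubt. From the right, y = 1/t turns it into
  \<open>y ^ Suc k / exp y\<close>.\<close>

lemma flat_tendsto_0: "((\<lambda>t. flat k t / t) \<longlongrightarrow> 0) (at 0)"
proof (rule filterlim_split_at)
  show "((\<lambda>t. flat k t / t) \<longlongrightarrow> 0) (at_left 0)"
    by (rule tendsto_eventually) (auto simp: flat_def eventually_at_filter)
  have "((\<lambda>y. y ^ Suc k / exp y) \<longlongrightarrow> (0::real)) at_top"
    by (rule tendsto_power_div_exp_0)
  then have "((\<lambda>t. inverse t ^ Suc k / exp (inverse t)) \<longlongrightarrow> (0::real)) (at_right 0)"
    by (rule filterlim_compose) (rule filterlim_inverse_at_top_right)
  then show "((\<lambda>t. flat k t / t) \<longlongrightarrow> 0) (at_right 0)"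
    by (rule Lim_transform_eventually)
      (auto simp: flat_def eventually_at_filter exp_minus inverse_eq_divide)
qed

text \<open>The index \<open>k\<close> exists for the sake of this formula: the functions t^(-k)
  exp(-1/t), continued by zero, have a linear span closed under differentiation. The case k = 0 is
  the classical smooth function that is not analytic at the origin.\<close>

lemma flat_has_real_derivative:
  "(flat k has_real_derivative (flat (k + 2) t - real k * flat (k + 1) t)) (at t)"
proof (cases t "0::real" rule: linorder_cases)
  case less
  have "((\<lambda>t. 0) has_real_derivative 0) (at t)" by simp
  then show ?thesis
    by (rule has_field_derivative_transform_within_open[where S = "{..<0}", OF DERIV_cong])
      (use less in \<open>auto simp: flat_def\<close>)
next
  case equal
  have "((\<lambda>y. flat k y / y) \<longlongrightarrow> 0) (at 0)" by (rule flat_tendsto_0)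
  then show ?thesis unfolding equal
    by (simp add: has_field_derivative_iff flat_def)
next
  case greater
  have "((\<lambda>t. (1 / t) ^ k * exp (- (1 / t))) has_real_derivative
          ((1 / t) ^ (k + 2) * exp (- (1 / t)) - real k * ((1 / t) ^ (k + 1) * exp (- (1 / t))))) (at t)"
    using greater
    apply (auto intro!: derivative_eq_intros simp: field_simps power2_eq_square)
    apply (cases k; simp add: field_simps)
    done
  then show ?thesis
    by (rule has_field_derivative_transform_within_open[where S = "{0<..}", OF DERIV_cong])
      (use greater in \<open>auto simp: flat_def\<close>)
qed

lemma flat_0_bounds: "0 \<le> flat 0 t" "flat 0 t \<le> 1"
  by (auto simp: flat_def)

lemma flat_0_pos_iff: "0 < flat 0 t \<longleftrightarrow> 0 < t"
  by (auto simp: flat_def)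

text \<open>An algebra on which partial derivatives act: they send generators to combinations of
  generators, and the sum and product rules do the rest. Smoothness of a member thus needs a single
  differentiation step, and no iterated derivative is ever computed.\<close>

inductive_set bump_algebra :: "(real^'d \<Rightarrow> real) set" where
  flat: "(\<lambda>x. flat k (x \<bullet> v + c)) \<in> bump_algebra"
| const: "(\<lambda>x. c) \<in> bump_algebra"
| add: "f \<in> bump_algebra \<Longrightarrow> g \<in> bump_algebra \<Longrightarrow> (\<lambda>x. f x + g x) \<in> bump_algebra"
| mult: "f \<in> bump_algebra \<Longrightarrow> g \<in> bump_algebra \<Longrightarrow> (\<lambda>x. f x * g x) \<in> bump_algebra"

lemma partial_deriv_eq:
  "(f has_derivative D) (at x) \<Longrightarrow> partial_deriv i f x = D (axis i 1)"
  by (simp add: partial_deriv_def frechet_derivative_at[symmetric])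

lemma bump_algebra_step:
  assumes "f \<in> bump_algebra"
  shows "f differentiable at x" and "partial_deriv i f \<in> bump_algebra"
proof -
  have "(\<forall>x. f differentiable at x) \<and> partial_deriv i f \<in> bump_algebra"
    using assms
  proof induction
    case (flat k v c)
    have d: "((\<lambda>x. flat k (x \<bullet> v + c)) has_derivative
        (\<lambda>h. (flat (k + 2) (x \<bullet> v + c) - real k * flat (k + 1) (x \<bullet> v + c)) * (h \<bullet> v))) (at x)" for x
    proof (rule has_derivative_compose[of "\<lambda>x. x \<bullet> v + c" "\<lambda>h. h \<bullet> v" x UNIV "flat k"])
      show "((\<lambda>x. x \<bullet> v + c) has_derivative (\<lambda>h. h \<bullet> v)) (at x)"
        by (auto intro!: derivative_eq_intros)
      show "(flat k has_derivative (*) (flat (k + 2) (x \<bullet> v + c) - real k * flat (k + 1) (x \<bullet> v + c)))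
              (at (x \<bullet> v + c))"
        using flat_has_real_derivative[of k] by (simp add: has_field_derivative_def)
    qed
    have "partial_deriv i (\<lambda>x. flat k (x \<bullet> v + c)) =
        (\<lambda>x. (axis i 1 \<bullet> v) * (flat (k + 2) (x \<bullet> v + c) + (- real k) * flat (k + 1) (x \<bullet> v + c)))"
      unfolding partial_deriv_eq[OF d] by (rule ext) (simp add: algebra_simps)
    moreover have "\<dots> \<in> bump_algebra"
      by (intro bump_algebra.mult bump_algebra.add bump_algebra.const bump_algebra.flat)
    ultimately show ?case
      using d by (auto simp: differentiable_def)
  next
    case (const c)
    have "partial_deriv i (\<lambda>x. c) = (\<lambda>x. 0)"
      by (rule ext) (rule partial_deriv_eq[OF has_derivative_const])
    then show ?case by (simp add: bump_algebra.const)
  next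
    case (add f g)
    then have D: "(f has_derivative frechet_derivative f (at x)) (at x)"
      "(g has_derivative frechet_derivative g (at x)) (at x)" for x
      by (auto simp: frechet_derivative_works)
    have "partial_deriv i (\<lambda>x. f x + g x) = (\<lambda>x. partial_deriv i f x + partial_deriv i g x)"
      by (rule ext) (simp add: partial_deriv_eq[OF has_derivative_add[OF D]] partial_deriv_def)
    then show ?case using add by (simp add: bump_algebra.add)
  next
    case (mult f g)
    then have D: "(f has_derivative frechet_derivative f (at x)) (at x)"
      "(g has_derivative frechet_derivative g (at x)) (at x)" for x
      by (auto simp: frechet_derivative_works)
    have "partial_deriv i (\<lambda>x. f x * g x) =
        (\<lambda>x. f x * partial_deriv i g x + partial_deriv i f x * g x)"
      by (rule ext) (simp add: partial_deriv_eq[OF has_derivative_mult[OF D]] partial_deriv_def)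
    then show ?case using mult by (simp add: bump_algebra.add bump_algebra.mult)
  qed
  then show "f differentiable at x" "partial_deriv i f \<in> bump_algebra" by auto
qed

lemma smooth_bump_algebra:
  assumes "f \<in> bump_algebra"
  shows "smooth f"
proof -
  have "foldr partial_deriv is f \<in> bump_algebra" for "is"
    by (induction "is") (simp_all add: assms bump_algebra_step)
  then show ?thesis by (simp add: smooth_def bump_algebra_step)
qed

lemma bump_algebra_prod:
  "(\<And>i. i \<in> I \<Longrightarrow> f i \<in> bump_algebra) \<Longrightarrow> (\<lambda>x. \<Prod>i\<in>I. f i x) \<in> bump_algebra"
proof (induction I rule: infinite_finite_induct)
  case (insert i I)
  then have "(\<lambda>x. f i x * (\<Prod>i\<in>I. f i x)) \<in> bump_algebra"
    using bump_algebra.mult by blast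
  then show ?case using insert.hyps by simp
qed (simp_all add: bump_algebra.const)

lemma bump_algebra_power:
  "f \<in> bump_algebra \<Longrightarrow> (\<lambda>x. f x ^ n) \<in> bump_algebra"
proof (induction n)
  case (Suc n)
  then have "(\<lambda>x. f x * f x ^ n) \<in> bump_algebra"
    using bump_algebra.mult by blast
  then show ?case by simp
qed (simp_all add: bump_algebra.const)

definition box_bump :: "real^'d \<Rightarrow> real^'d \<Rightarrow> real^'d \<Rightarrow> real" where
  "box_bump a b x = (\<Prod>i\<in>UNIV. flat 0 (x $ i - a $ i) * flat 0 (b $ i - x $ i))"

lemma box_bump_bounds: "0 \<le> box_bump a b x" "box_bump a b x \<le> 1"
proof -
  have *: "0 \<le> flat 0 (x $ i - a $ i) * flat 0 (b $ i - x $ i) \<and>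
      flat 0 (x $ i - a $ i) * flat 0 (b $ i - x $ i) \<le> 1" for i
    by (metis flat_0_bounds mult_le_one mult_nonneg_nonneg)
  show "0 \<le> box_bump a b x" unfolding box_bump_def by (rule prod_nonneg) (use * in blast)
  show "box_bump a b x \<le> 1" unfolding box_bump_def by (rule prod_le_1) (use * in blast)
qed

lemma box_bump_pos:
  assumes "x \<in> box a b" shows "0 < box_bump a b x"
proof -
  have "0 < flat 0 (x $ i - a $ i) * flat 0 (b $ i - x $ i)" for i
    using assms by (simp add: mem_box_cart flat_0_pos_iff)
  then show ?thesis unfolding box_bump_def by (rule prod_pos)
qed

lemma box_bump_eq_0:
  assumes "x \<notin> box a b" shows "box_bump a b x = 0"
proof -
  obtain i where "x $ i - a $ i \<le> 0 \<or> b $ i - x $ i \<le> 0"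
    using assms by (auto simp: mem_box_cart not_less)
  then have "flat 0 (x $ i - a $ i) * flat 0 (b $ i - x $ i) = 0"
    by (auto simp: flat_def)
  then show ?thesis unfolding box_bump_def by (intro prod_zero) auto
qed

lemma box_bump_in_bump_algebra: "box_bump a b \<in> bump_algebra"
proof -
  have *: "box_bump a b = (\<lambda>x. \<Prod>i\<in>UNIV.
      flat 0 (x \<bullet> axis i 1 + (- a $ i)) * flat 0 (x \<bullet> (- axis i 1) + b $ i))"
    by (rule ext) (simp add: box_bump_def inner_axis)
  show ?thesis unfolding *
    by (intro bump_algebra_prod bump_algebra.mult bump_algebra.flat)
qed

text \<open>These test functions increase to the indicator function of an open box.\<close>

definition box_test :: "real^'d \<Rightarrow> real^'d \<Rightarrow> nat \<Rightarrow> real^'d \<Rightarrow> real" where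
  "box_test a b n x = 1 - (1 - box_bump a b x) ^ n"

lemma box_test_in_test_functions:
  assumes "cbox a b \<subseteq> \<Omega>"
  shows "box_test a b n \<in> test_functions \<Omega>"
proof -
  have *: "box_test a b n = (\<lambda>x. 1 + (- 1) * (1 + (- 1) * box_bump a b x) ^ n)"
    by (rule ext) (simp add: box_test_def)
  have "box_test a b n \<in> bump_algebra" unfolding *
    by (intro bump_algebra.add bump_algebra.mult bump_algebra.const bump_algebra_power
        box_bump_in_bump_algebra)
  moreover have "{x. box_test a b n x \<noteq> 0} \<subseteq> box a b"
    using box_bump_eq_0[of _ a b] by (fastforce simp: box_test_def)
  then have "closure {x. box_test a b n x \<noteq> 0} \<subseteq> cbox a b"
    by (meson box_subset_cbox closed_cbox closure_minimal subset_trans)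
  then have "closure {x. box_test a b n x \<noteq> 0} \<subseteq> \<Omega>"
    "compact (closure {x. box_test a b n x \<noteq> 0})"
    using assms bounded_subset[OF bounded_cbox] by (auto simp: compact_eq_bounded_closed)
  ultimately show ?thesis
    by (simp add: test_functions_def smooth_bump_algebra)
qed

lemma box_test_bound: "\<bar>box_test a b n x\<bar> \<le> indicator (box a b) x"
proof (cases "x \<in> box a b")
  case True
  have "0 \<le> (1 - box_bump a b x) ^ n" "(1 - box_bump a b x) ^ n \<le> 1"
    using box_bump_bounds[of a b x] by (simp_all add: power_le_one)
  then show ?thesis using True by (simp add: box_test_def)
qed (simp add: box_test_def box_bump_eq_0)

lemma box_test_tendsto: "(\<lambda>n. box_test a b n x) \<longlonglongrightarrow> indicator (box a b) x"
proof (cases "x \<in> box a b")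
  case True
  have "(\<lambda>n. (1 - box_bump a b x) ^ n) \<longlonglongrightarrow> 0"
    using box_bump_pos[OF True] box_bump_bounds[of a b x] by (intro LIMSEQ_power_zero) auto
  then have "(\<lambda>n. box_test a b n x) \<longlonglongrightarrow> 1 - 0"
    unfolding box_test_def by (rule tendsto_diff[OF tendsto_const])
  then show ?thesis using True by simp
qed (simp add: box_test_def box_bump_eq_0)


subsection \<open>Uniqueness and locality of weak derivatives\<close>

text \<open>Open boxes are stable under intersection and generate the Borel sets, so Dynkin's lemma
  extends the vanishing from boxes to Borel sets; the hypothesis on the whole space serves the
  complement step. A density whose integrals over all measurable sets vanish is zero almost
  everywhere.\<close>

lemma zero_AE_if_box_integrals_zero:
  fixes f :: "'a::euclidean_space \<Rightarrow> real"
  assumes int: "integrable lebesgue f"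
    and univ: "(\<integral>x. f x \<partial>lebesgue) = 0"
    and box: "\<And>a b. (\<integral>x. indicator (box a b) x * f x \<partial>lebesgue) = 0"
  shows "AE x in lebesgue. f x = 0"
proof (rule density_unique_real[OF int integrable_zero])
  have si: "set_integrable lebesgue A f" if "A \<in> sets lebesgue" for A
    unfolding set_integrable_def using integrable_mult_indicator[OF that int] .
  have borel: "(\<integral>x\<in>A. f x \<partial>lebesgue) = 0" if "A \<in> sets borel" for A
  proof -
    have sets: "B \<in> sets lebesgue" if "B \<in> sigma_sets UNIV (range (\<lambda>(a, b). box a b :: 'a set))" for B
    proof -
      have "B \<in> sets (sigma UNIV (range (\<lambda>(a, b). box a b :: 'a set)))" using that by simp
      then show ?thesis unfolding borel_eq_box[symmetric] by simp
    qed
    have A: "A \<in> sigma_sets UNIV (range (\<lambda>(a, b). box a b :: 'a set))"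
      using that by (subst (asm) borel_eq_box) simp
    have stable: "Int_stable (range (\<lambda>(a, b). box a b :: 'a set))"
      by (auto simp: Int_stable_def box_Int_box)
    show ?thesis
    proof (rule sigma_sets_induct_disjoint[OF stable _ A])
      fix B assume B: "B \<in> sigma_sets UNIV (range (\<lambda>(a, b). box a b :: 'a set))"
        "(\<integral>x\<in>B. f x \<partial>lebesgue) = 0"
      have "(\<integral>x\<in>UNIV - B \<union> B. f x \<partial>lebesgue) = (\<integral>x\<in>UNIV - B. f x \<partial>lebesgue) + (\<integral>x\<in>B. f x \<partial>lebesgue)"
        using sets[OF B(1)] by (intro set_integral_Un si) auto
      then show "(\<integral>x\<in>UNIV - B. f x \<partial>lebesgue) = 0"
        using B univ by (simp add: set_lebesgue_integral_def)
    next
      fix B :: "nat \<Rightarrow> 'a set"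
      assume B: "disjoint_family B"
        "range B \<subseteq> sigma_sets UNIV (range (\<lambda>(a, b). box a b :: 'a set))"
        "\<And>i. (\<integral>x\<in>B i. f x \<partial>lebesgue) = 0"
      then have "range B \<subseteq> sets lebesgue" using sets by blast
      then have "(\<integral>x\<in>\<Union>(range B). f x \<partial>lebesgue) = (\<Sum>i. \<integral>x\<in>B i. f x \<partial>lebesgue)"
        using B(1) by (intro lebesgue_integral_countable_add)
          (auto simp: disjoint_family_on_def intro!: si)
      then show "(\<integral>x\<in>\<Union>(range B). f x \<partial>lebesgue) = 0" using B(3) by simp
    qed (auto simp: set_lebesgue_integral_def box)
  qed
  \<comment> \<open>A Lebesgue set is a Borel set up to a subset of a null set, which integrals do
    not see.\<close>
  fix A :: "'a set" assume "A \<in> sets lebesgue"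
  then obtain S N N' where A: "A = S \<union> N" "N \<subseteq> N'" "N' \<in> null_sets lborel" "S \<in> sets lborel"
    by (rule sets_completionE)
  then have "AE x in lebesgue. x \<notin> N"
    by (intro AE_not_in) (meson null_sets_completionI null_sets_completion_subset)
  then have "AE x in lebesgue. (x \<in> A) = (x \<in> S)" by eventually_elim (auto simp: A)
  then have "(\<integral>x\<in>A. f x \<partial>lebesgue) = (\<integral>x\<in>S. f x \<partial>lebesgue)"
    using A(4) \<open>A \<in> sets lebesgue\<close> borel_measurable_integrable[OF si[unfolded set_integrable_def]]
    by (intro set_integral_cong_set) (auto simp: set_borel_measurable_def)
  also have "\<dots> = 0" using borel A by simp
  finally show "(\<integral>x\<in>A. f x \<partial>lebesgue) = (\<integral>x\<in>A. 0 \<partial>lebesgue)" by (simp add: set_lebesgue_integral_def)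
qed

section \<open>From vanishing test integrals to vanishing almost everywhere\<close>

lemma test_functionsD:
  assumes "\<phi> \<in> test_functions \<Omega>"
  shows "continuous_on A \<phi>" and "compact (closure {x. \<phi> x \<noteq> 0})"
    and "closure {x. \<phi> x \<noteq> 0} \<subseteq> \<Omega>"
proof -
  have "foldr partial_deriv [] \<phi> differentiable at x" for x
    using assms unfolding test_functions_def smooth_def by blast
  then show "continuous_on A \<phi>"
    by (simp add: differentiable_imp_continuous_within continuous_at_imp_continuous_on)
qed (use assms in \<open>auto simp: test_functions_def\<close>)

lemma integrable_mult_test_function:
  assumes "open \<Omega>" "locally_integrable \<Omega> g" "\<phi> \<in> test_functions \<Omega>"
  shows "integrable (lebesgue_on \<Omega>) (\<lambda>x. g x * \<phi> x)"
proof -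
  define K where "K = closure {x. \<phi> x \<noteq> 0}"
  have K: "compact K" "K \<subseteq> \<Omega>" "\<And>x. x \<notin> K \<Longrightarrow> \<phi> x = 0"
    using test_functionsD[OF assms(3)] closure_subset[of "{x. \<phi> x \<noteq> 0}"] by (auto simp: K_def)
  have "(\<lambda>x. \<phi> x * g x) absolutely_integrable_on K"
  proof (rule absolutely_integrable_bounded_measurable_product[OF bilinear_times])
    show "bounded (\<phi> ` K)"
      by (intro compact_imp_bounded compact_continuous_image test_functionsD[OF assms(3)] K)
    show "\<phi> \<in> borel_measurable (lebesgue_on K)"
      using K by (intro continuous_imp_measurable_on_sets_lebesgue test_functionsD[OF assms(3)])
        (auto intro: fmeasurableD fmeasurable_compact)
    show "g absolutely_integrable_on K"
      using assms(2) K by (auto simp: locally_integrable_def)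
  qed (use K in \<open>auto intro: fmeasurableD fmeasurable_compact\<close>)
  moreover have "indicator K x *\<^sub>R (\<phi> x * g x) = indicator \<Omega> x *\<^sub>R (g x * \<phi> x)" for x
    using K by (cases "x \<in> K") (auto simp: indicator_def)
  ultimately show ?thesis
    using assms(1) by (simp add: integrable_restrict_space set_integrable_def del: real_scaleR_def)
qed

lemma AE_lebesgue_on_iff:
  "S \<in> sets lebesgue \<Longrightarrow> (AE x in lebesgue_on S. P x) \<longleftrightarrow> (AE x in lebesgue. x \<in> S \<longrightarrow> P x)"
  by (simp add: AE_restrict_space_iff)

text \<open>The functions \<open>box_test a b n\<close> are admissible because the closed box lies
  in \<Omega>. They are dominated by the indicator of the open box and converge to it, so dominated
  convergence carries the vanishing to the limit.\<close>

lemma box_integral_zero_if_test_integrals_zero: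
  assumes \<Omega>: "open \<Omega>" "locally_integrable \<Omega> g"
    and zero: "\<And>\<phi>. \<phi> \<in> test_functions \<Omega> \<Longrightarrow> (\<integral>x. g x * \<phi> x \<partial>lebesgue_on \<Omega>) = 0"
    and cbox: "cbox a b \<subseteq> \<Omega>"
  shows "(\<integral>x. indicator (box a b) x * g x \<partial>lebesgue) = 0"
proof -
  \<comment> \<open>Since \<open>box_test\<close> vanishes off the open box, integrals over \<Omega>
    become integrals over the whole space; the extra indicator of the closed box makes
    \<open>g\<close> integrable there.\<close>
  have eq: "indicator \<Omega> x *\<^sub>R (g x * box_test a b n x) = box_test a b n x * (indicator (cbox a b) x * g x)" for n x
  proof (cases "x \<in> box a b")
    case True
    then have "x \<in> cbox a b" "x \<in> \<Omega>" using cbox box_subset_cbox[of a b] by auto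
    then show ?thesis by simp
  next
    case False
    then show ?thesis using box_test_bound[of a b n x] by simp
  qed
  have gc: "integrable lebesgue (\<lambda>x. indicator (cbox a b) x * g x)"
    using \<Omega> cbox by (auto simp: locally_integrable_def set_integrable_def)
  have g: "integrable lebesgue (\<lambda>x. indicator (box a b) x * g x)"
    using integrable_mult_indicator[OF _ gc, of "box a b"] box_subset_cbox[of a b]
    by (simp add: indicator_inter_arith[symmetric] Int_absorb2 flip: mult.assoc)
  have "(\<lambda>n. \<integral>x. box_test a b n x * (indicator (cbox a b) x * g x) \<partial>lebesgue)
      \<longlonglongrightarrow> (\<integral>x. indicator (box a b) x * g x \<partial>lebesgue)"
  proof (rule integral_dominated_convergence)
    show "integrable lebesgue (\<lambda>x. \<bar>indicator (box a b) x * g x\<bar>)" using g by simp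
    show "(\<lambda>x. indicator (box a b) x * g x) \<in> borel_measurable lebesgue" using g by simp
    have "indicator (cbox a b) x * (y::real) = y" if "x \<in> box a b" for x y
      using that box_subset_cbox[of a b] by auto
    then have *: "indicator (box a b) x * (indicator (cbox a b) x * g x) = indicator (box a b) x * g x" for x
      by (cases "x \<in> box a b") auto
    show "AE x in lebesgue. (\<lambda>n. box_test a b n x * (indicator (cbox a b) x * g x))
        \<longlonglongrightarrow> indicator (box a b) x * g x"
      by (rule AE_I2, subst *[symmetric]) (intro tendsto_mult box_test_tendsto tendsto_const)
    show "AE x in lebesgue. norm (box_test a b n x * (indicator (cbox a b) x * g x))
        \<le> \<bar>indicator (box a b) x * g x\<bar>" for n
    proof (rule AE_I2)
      fix x
      have "\<bar>box_test a b n x\<bar> * \<bar>indicator (cbox a b) x * g x\<bar>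
          \<le> indicator (box a b) x * \<bar>indicator (cbox a b) x * g x\<bar>"
        by (intro mult_right_mono box_test_bound) simp
      then show "norm (box_test a b n x * (indicator (cbox a b) x * g x)) \<le> \<bar>indicator (box a b) x * g x\<bar>"
        unfolding *[of x, symmetric] by (simp add: abs_mult)
    qed
    show "(\<lambda>x. box_test a b n x * (indicator (cbox a b) x * g x)) \<in> borel_measurable lebesgue" for n
      using integrable_mult_test_function[OF \<Omega> box_test_in_test_functions[OF cbox], of n] \<Omega>(1)
      by (auto simp: integrable_restrict_space eq simp del: real_scaleR_def)
  qed
  moreover have "(\<integral>x. box_test a b n x * (indicator (cbox a b) x * g x) \<partial>lebesgue) = 0" for n
    using zero[OF box_test_in_test_functions[OF cbox], of n] \<Omega>(1)
    by (simp add: integral_restrict_space eq del: real_scaleR_def)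
  ultimately show ?thesis
    by (simp add: LIMSEQ_const_iff)
qed

text \<open>On a closed box inside \<Omega>, \<open>g\<close> cut off to the open box is globally
  integrable, and its integral over any other box is an integral of \<open>g\<close> over an
  intersection, again a box. Countably many closed boxes exhaust \<Omega>.\<close>

lemma fundamental_lemma_calculus_of_variations:
  assumes \<Omega>: "open \<Omega>" "locally_integrable \<Omega> g"
    and zero: "\<And>\<phi>. \<phi> \<in> test_functions \<Omega> \<Longrightarrow> (\<integral>x. g x * \<phi> x \<partial>lebesgue_on \<Omega>) = 0"
  shows "AE x in lebesgue_on \<Omega>. g x = 0"
proof -
  have AE_box: "AE x in lebesgue. x \<in> cbox a b \<longrightarrow> g x = 0" if ab: "cbox a b \<subseteq> \<Omega>" for a b
  proof -
    let ?f = "\<lambda>x. indicator (box a b) x * g x"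
    have gc: "integrable lebesgue (\<lambda>x. indicator (cbox a b) x * g x)"
      using \<Omega> ab by (auto simp: locally_integrable_def set_integrable_def)
    have "AE x in lebesgue. ?f x = 0"
    proof (rule zero_AE_if_box_integrals_zero)
      show "integrable lebesgue ?f"
        using integrable_mult_indicator[OF _ gc, of "box a b"] box_subset_cbox[of a b]
        by (simp add: indicator_inter_arith[symmetric] Int_absorb2 flip: mult.assoc)
      show "(\<integral>x. ?f x \<partial>lebesgue) = 0"
        by (rule box_integral_zero_if_test_integrals_zero[OF \<Omega> zero ab])
      show "(\<integral>x. indicator (box c d) x * ?f x \<partial>lebesgue) = 0" for c d
      proof -
        obtain c' d' where cd: "box c d \<inter> box a b = box c' d'" using box_Int_box by blast
        have *: "indicator (box c d) x * ?f x = indicator (box c' d') x * g x" for x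
          by (simp add: indicator_inter_arith flip: cd mult.assoc)
        show ?thesis
        \<comment> \<open>An empty \<open>box c' d'\<close> does not control
          \<open>cbox c' d'\<close>, which may be degenerate but nonempty and leave \<Omega>. In
          that case the integral is trivially zero.\<close>
        proof (cases "box c' d' = {}")
          case False
          then have "cbox c' d' = closure (box c' d')" by simp
          also have "\<dots> \<subseteq> cbox a b"
            using cd box_subset_cbox[of a b] by (intro closure_minimal) auto
          finally show ?thesis
            unfolding * using ab by (intro box_integral_zero_if_test_integrals_zero[OF \<Omega> zero]) auto
        qed (simp add: *)
      qed
    qed
    moreover have "AE x in lebesgue. x \<notin> cbox a b - box a b"
      using negligible_frontier_interval by (intro AE_not_in) (simp add: negligible_iff_null_sets)
    ultimately show ?thesis by eventually_elim (auto simp: indicator_def split: if_splits)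
  qed
  obtain D where D: "countable D" "\<And>X. X \<in> D \<Longrightarrow> \<exists>a b. X = cbox a b" "\<Union>D = \<Omega>"
    by (rule open_countable_Union_open_cbox[OF \<Omega>(1)]) blast
  have "AE x in lebesgue. x \<in> X \<longrightarrow> g x = 0" if X: "X \<in> D" for X
  proof -
    obtain a b where "X = cbox a b" using D(2)[OF X] by blast
    then show ?thesis using AE_box[of a b] D(3) X by blast
  qed
  then have "AE x in lebesgue. \<forall>X\<in>D. x \<in> X \<longrightarrow> g x = 0"
    using D(1) by (subst AE_ball_countable) auto
  then have "AE x in lebesgue. x \<in> \<Omega> \<longrightarrow> g x = 0"
    by eventually_elim (use D(3) in blast)
  then show ?thesis using \<Omega>(1) by (simp add: AE_lebesgue_on_iff)
qed

section \<open>Iterated derivatives of test functions\<close>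

lemma smooth_foldr_partial_deriv: "smooth \<phi> \<Longrightarrow> smooth (foldr partial_deriv is \<phi>)"
proof (unfold smooth_def, intro allI)
  fix js x assume "\<forall>is x. foldr partial_deriv is \<phi> differentiable at x"
  then have "foldr partial_deriv (js @ is) \<phi> differentiable at x" by blast
  then show "foldr partial_deriv js (foldr partial_deriv is \<phi>) differentiable at x" by simp
qed

lemma partial_deriv_zero_off_support:
  assumes "closed K" "\<And>x. x \<notin> K \<Longrightarrow> f x = 0" "x \<notin> K"
  shows "partial_deriv i f x = 0"
proof -
  have "(f has_derivative (\<lambda>h. 0)) (at x)"
    by (rule has_derivative_transform_within_open[where s = "- K" and f = "\<lambda>x. 0"])
      (use assms in auto)
  then show ?thesis by (simp add: partial_deriv_eq)
qed

lemma foldr_partial_deriv_in_test_functions: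
  assumes "\<phi> \<in> test_functions \<Omega>"
  shows "foldr partial_deriv is \<phi> \<in> test_functions \<Omega>"
proof -
  define K where "K = closure {x. \<phi> x \<noteq> 0}"
  have 0: "x \<notin> K \<Longrightarrow> foldr partial_deriv is \<phi> x = 0" for x
  proof (induction "is" arbitrary: x)
    case Nil
    then show ?case using closure_subset[of "{x. \<phi> x \<noteq> 0}"] by (auto simp: K_def)
  next
    case (Cons i "is")
    then show ?case using partial_deriv_zero_off_support[of K] by (simp add: K_def)
  qed
  then have "closure {x. foldr partial_deriv is \<phi> x \<noteq> 0} \<subseteq> K"
    by (intro closure_minimal) (auto simp: K_def)
  moreover have "compact K" "K \<subseteq> \<Omega>"
    using test_functionsD[OF assms] by (auto simp: K_def)
  ultimately have "closure {x. foldr partial_deriv is \<phi> x \<noteq> 0} \<subseteq> \<Omega>"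
    "compact (closure {x. foldr partial_deriv is \<phi> x \<noteq> 0})"
    using bounded_subset[of K] by (auto simp: compact_eq_bounded_closed)
  then show ?thesis
    using assms by (simp add: test_functions_def smooth_foldr_partial_deriv)
qed

lemma multi_deriv_in_test_functions:
  "\<phi> \<in> test_functions \<Omega> \<Longrightarrow> multi_deriv \<alpha> \<phi> \<in> test_functions \<Omega>"
  unfolding multi_deriv_def by (rule foldr_partial_deriv_in_test_functions)

section \<open>Linearity, locality and uniqueness of weak derivatives\<close>

lemma locally_integrable_linear:
  assumes "locally_integrable \<Omega> f" "locally_integrable \<Omega> g"
  shows "locally_integrable \<Omega> (\<lambda>x. c * f x + d * g x)"
  using assms unfolding locally_integrable_def by (auto intro!: set_integral_add)

lemma has_weak_deriv_linear:
  assumes "open \<Omega>" "has_weak_deriv \<Omega> \<alpha> f1 g1" "has_weak_deriv \<Omega> \<alpha> f2 g2"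
  shows "has_weak_deriv \<Omega> \<alpha> (\<lambda>x. c * f1 x + d * f2 x) (\<lambda>x. c * g1 x + d * g2 x)"
proof -
  have li: "locally_integrable \<Omega> f1" "locally_integrable \<Omega> g1"
    "locally_integrable \<Omega> f2" "locally_integrable \<Omega> g2"
    using assms by (auto simp: has_weak_deriv_def)
  have lin: "(\<integral>x. (c * f x + d * g x) * \<phi> x \<partial>lebesgue_on \<Omega>) =
      c * (\<integral>x. f x * \<phi> x \<partial>lebesgue_on \<Omega>) + d * (\<integral>x. g x * \<phi> x \<partial>lebesgue_on \<Omega>)"
    if "locally_integrable \<Omega> f" "locally_integrable \<Omega> g" "\<phi> \<in> test_functions \<Omega>" for f g \<phi>
    using integrable_mult_test_function[OF assms(1)] that
    by (simp add: distrib_right mult.assoc)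
  show ?thesis
    using assms(2,3) li unfolding has_weak_deriv_def
    by (auto simp: locally_integrable_linear lin multi_deriv_in_test_functions distrib_left mult.left_commute)
qed

text \<open>A test function on \<open>U\<close> is also one on \<Omega>, with the same integrals
  over both sets. Tested against it, \<open>g\<close> is determined by the values of
  \<open>f\<close> on \<open>U\<close> alone, so the fundamental lemma applies on
  \<open>U\<close>.\<close>

lemma weak_deriv_zero_where_zero:
  assumes "open \<Omega>" "has_weak_deriv \<Omega> \<alpha> f g" "open U" "U \<subseteq> \<Omega>"
    and f: "AE x in lebesgue_on U. f x = 0"
  shows "AE x in lebesgue_on U. g x = 0"
proof (rule fundamental_lemma_calculus_of_variations[OF \<open>open U\<close>])
  show "locally_integrable U g"
    using assms(2,4) by (auto simp: has_weak_deriv_def locally_integrable_def)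
  fix \<phi> assume \<phi>: "\<phi> \<in> test_functions U"
  then have \<phi>': "\<phi> \<in> test_functions \<Omega>" using assms(4) by (auto simp: test_functions_def)
  have D: "multi_deriv \<alpha> \<phi> \<in> test_functions U" by (rule multi_deriv_in_test_functions[OF \<phi>])
  have off: "\<psi> x = 0" if "\<psi> \<in> test_functions U" "x \<notin> U" for \<psi> x
    using that closure_subset[of "{x. \<psi> x \<noteq> 0}"] by (auto simp: test_functions_def)
  have restrict: "(\<integral>x. h x * \<psi> x \<partial>lebesgue_on U) = (\<integral>x. h x * \<psi> x \<partial>lebesgue_on \<Omega>)"
    if "\<psi> \<in> test_functions U" for h \<psi>
  proof -
    have "(\<lambda>x. indicator U x *\<^sub>R (h x * \<psi> x)) = (\<lambda>x. indicator \<Omega> x *\<^sub>R (h x * \<psi> x))"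
    proof
      fix x show "indicator U x *\<^sub>R (h x * \<psi> x) = indicator \<Omega> x *\<^sub>R (h x * \<psi> x)"
        using off[OF that] assms(4) by (cases "x \<in> U") auto
    qed
    then show ?thesis
      using assms(1,3) by (subst (1 2) integral_restrict_space) simp_all
  qed
  have "AE x in lebesgue_on U. f x * multi_deriv \<alpha> \<phi> x = 0" using f by eventually_elim simp
  then have "(\<integral>x. f x * multi_deriv \<alpha> \<phi> x \<partial>lebesgue_on U) = 0" by (rule integral_eq_zero_AE)
  then have "(\<integral>x. g x * \<phi> x \<partial>lebesgue_on \<Omega>) = 0"
    using assms(2) \<phi>' restrict[OF D] by (simp add: has_weak_deriv_def)
  then show "(\<integral>x. g x * \<phi> x \<partial>lebesgue_on U) = 0" using restrict[OF \<phi>] by simp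
qed

text \<open>The difference of two weak derivatives of \<open>f\<close> is a weak derivative of f - f
  = 0; locality is then used with U = \<Omega>.\<close>

lemma has_weak_deriv_unique:
  assumes "open \<Omega>" "has_weak_deriv \<Omega> \<alpha> f g" "has_weak_deriv \<Omega> \<alpha> f g'"
  shows "AE x in lebesgue_on \<Omega>. g x = g' x"
proof -
  have "AE x in lebesgue_on \<Omega>. 1 * g x + (- 1) * g' x = 0"
    by (rule weak_deriv_zero_where_zero[OF assms(1) has_weak_deriv_linear[OF assms, of 1 "- 1"] assms(1)]) auto
  then show ?thesis by eventually_elim simp
qed

text \<open>The complement is a union of possibly uncountably many open sets, whose exceptional null
  sets cannot simply be joined. By the Lindelof property countably many of these open sets already
  cover it.\<close>

lemma ess_support_complement_AE:
  assumes "open \<Omega>"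
  shows "open (\<Omega> - ess_support \<Omega> f)" and "AE x in lebesgue_on (\<Omega> - ess_support \<Omega> f). f x = 0"
proof -
  let ?F = "{U. open U \<and> U \<subseteq> \<Omega> \<and> (AE x in lebesgue_on U. f x = 0)}"
  have *: "\<Omega> - ess_support \<Omega> f = \<Union>?F" unfolding ess_support_def by blast
  show "open (\<Omega> - ess_support \<Omega> f)" unfolding * by auto
  obtain F' where F': "F' \<subseteq> ?F" "countable F'" "\<Union>F' = \<Union>?F"
    using Lindelof[of ?F] by auto
  have "AE x in lebesgue. \<forall>U\<in>F'. x \<in> U \<longrightarrow> f x = 0"
    using F'(1) by (subst AE_ball_countable[OF F'(2)]) (auto simp: AE_lebesgue_on_iff)
  then have "AE x in lebesgue. x \<in> \<Union>?F \<longrightarrow> f x = 0"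
    unfolding F'(3)[symmetric] by eventually_elim blast
  then show "AE x in lebesgue_on (\<Omega> - ess_support \<Omega> f). f x = 0"
    unfolding * by (subst AE_lebesgue_on_iff) (simp_all add: borel_open open_Union)
qed

lemma weak_deriv_AE_zero_off_ess_support:
  assumes "open \<Omega>" "has_weak_deriv \<Omega> \<alpha> f g"
  shows "AE x in lebesgue_on \<Omega>. x \<notin> ess_support \<Omega> f \<longrightarrow> g x = 0"
proof -
  have "AE x in lebesgue_on (\<Omega> - ess_support \<Omega> f). g x = 0"
    by (rule weak_deriv_zero_where_zero[OF assms]) (auto simp: ess_support_complement_AE assms)
  then show ?thesis
    using ess_support_complement_AE(1)[OF assms(1), of f] assms(1)
    by (auto simp: AE_lebesgue_on_iff elim: eventually_mono)
qed


subsection \<open>Lebesgue norms\<close>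

lemma exponent_cases:
  assumes "1 \<le> (p::ennreal)"
  obtains "p = \<infinity>" | P where "p = ennreal P" "1 \<le> P"
proof (cases p)
  case (real P)
  then have "1 \<le> P" using assms by (simp flip: ennreal_1)
  then show ?thesis using real that by blast
qed (use that in auto)

lemma Lp_space_ennreal:
  "1 \<le> P \<Longrightarrow> f \<in> Lp_space \<Omega> (ennreal P) \<longleftrightarrow>
     f \<in> borel_measurable (lebesgue_on \<Omega>) \<and> integrable (lebesgue_on \<Omega>) (\<lambda>x. \<bar>f x\<bar> powr P)"
  by (simp add: Lp_space_def)

lemma Lp_norm_ennreal:
  "1 \<le> P \<Longrightarrow> Lp_norm \<Omega> (ennreal P) f = (\<integral>x. \<bar>f x\<bar> powr P \<partial>lebesgue_on \<Omega>) powr (1 / P)"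
  by (simp add: Lp_norm_def)

lemma Lp_space_infinity:
  assumes "f \<in> borel_measurable (lebesgue_on \<Omega>)" "AE x in lebesgue_on \<Omega>. \<bar>f x\<bar> \<le> B"
  shows "f \<in> Lp_space \<Omega> \<infinity>" and "0 \<le> B \<Longrightarrow> Lp_norm \<Omega> \<infinity> f \<le> B"
proof -
  have "AE x in lebesgue_on \<Omega>. ennreal \<bar>f x\<bar> \<le> ennreal B"
    using assms(2) by eventually_elim (rule ennreal_leI)
  then have *: "esssup (lebesgue_on \<Omega>) (\<lambda>x. ennreal \<bar>f x\<bar>) \<le> ennreal B"
    using assms(1) by (intro esssup_I) auto
  then show "f \<in> Lp_space \<Omega> \<infinity>"
    using assms(1) by (auto simp: Lp_space_def intro: le_less_trans)
  show "Lp_norm \<Omega> \<infinity> f \<le> B" if "0 \<le> B"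
    using * that by (simp add: Lp_norm_def enn2real_leI)
qed

lemma AE_le_Lp_norm_infinity:
  assumes "f \<in> Lp_space \<Omega> \<infinity>"
  shows "AE x in lebesgue_on \<Omega>. \<bar>f x\<bar> \<le> Lp_norm \<Omega> \<infinity> f"
proof -
  have "esssup (lebesgue_on \<Omega>) (\<lambda>x. ennreal \<bar>f x\<bar>) < \<infinity>"
    using assms by (simp add: Lp_space_def)
  then have "ennreal (Lp_norm \<Omega> \<infinity> f) = esssup (lebesgue_on \<Omega>) (\<lambda>x. ennreal \<bar>f x\<bar>)"
    by (simp add: Lp_norm_def)
  then have "AE x in lebesgue_on \<Omega>. ennreal \<bar>f x\<bar> \<le> ennreal (Lp_norm \<Omega> \<infinity> f)"
    using esssup_AE[of "\<lambda>x. ennreal \<bar>f x\<bar>" "lebesgue_on \<Omega>"] by simp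
  then show ?thesis
    by eventually_elim (simp add: Lp_norm_def)
qed

lemma Lp_norm_nonneg: "0 \<le> Lp_norm \<Omega> p f"
  by (simp add: Lp_norm_def)

lemma Lp_space_measurable: "f \<in> Lp_space \<Omega> p \<Longrightarrow> f \<in> borel_measurable (lebesgue_on \<Omega>)"
  by (simp add: Lp_space_def)

text \<open>Domination by |f| + |g| lets one lemma serve sums, differences and functions equal
  almost everywhere. It rests on (x + y)^P \<le> 2^P (x^P + y^P) instead of Minkowski's inequality;
  the constant 4 is free of the exponent because 2 * 2^P \<le> 4^P for P \<ge> 1.\<close>

lemma Lp_quasi_triangle:
  assumes p: "1 \<le> p" and f: "f \<in> Lp_space \<Omega> p" and g: "g \<in> Lp_space \<Omega> p"
    and h: "h \<in> borel_measurable (lebesgue_on \<Omega>)"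
    and le: "AE x in lebesgue_on \<Omega>. \<bar>h x\<bar> \<le> \<bar>f x\<bar> + \<bar>g x\<bar>"
  shows "h \<in> Lp_space \<Omega> p" and "Lp_norm \<Omega> p h \<le> 4 * (Lp_norm \<Omega> p f + Lp_norm \<Omega> p g)"
proof -
  have "h \<in> Lp_space \<Omega> p \<and> Lp_norm \<Omega> p h \<le> 4 * (Lp_norm \<Omega> p f + Lp_norm \<Omega> p g)"
    using p
  proof (cases rule: exponent_cases)
    case 1
    have "AE x in lebesgue_on \<Omega>. \<bar>h x\<bar> \<le> Lp_norm \<Omega> \<infinity> f + Lp_norm \<Omega> \<infinity> g"
      using le AE_le_Lp_norm_infinity[OF f[unfolded 1]] AE_le_Lp_norm_infinity[OF g[unfolded 1]]
      by eventually_elim simp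
    note * = Lp_space_infinity[OF h this]
    then show ?thesis
      using Lp_norm_nonneg[of \<Omega> \<infinity> f] Lp_norm_nonneg[of \<Omega> \<infinity> g] by (simp add: 1)
  next
    case (2 P)
    let ?M = "lebesgue_on \<Omega>"
    have int: "integrable ?M (\<lambda>x. \<bar>f x\<bar> powr P)" "integrable ?M (\<lambda>x. \<bar>g x\<bar> powr P)"
      using f g 2 by (simp_all add: Lp_space_ennreal)
    define F where "F = Lp_norm \<Omega> p f"
    define G where "G = Lp_norm \<Omega> p g"
    have FG: "F \<ge> 0" "G \<ge> 0" by (simp_all add: F_def G_def Lp_norm_nonneg)
    have F: "(\<integral>x. \<bar>f x\<bar> powr P \<partial>?M) = F powr P" and G: "(\<integral>x. \<bar>g x\<bar> powr P \<partial>?M) = G powr P"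
      using 2 by (simp_all add: F_def G_def Lp_norm_ennreal powr_powr)
    have pw: "AE x in ?M. \<bar>h x\<bar> powr P \<le> 2 powr P * (\<bar>f x\<bar> powr P + \<bar>g x\<bar> powr P)"
      using le
    proof eventually_elim
      case (elim x)
      have "\<bar>h x\<bar> powr P \<le> (2 * max \<bar>f x\<bar> \<bar>g x\<bar>) powr P"
        using elim 2 by (intro powr_mono2) auto
      also have "\<dots> = 2 powr P * max \<bar>f x\<bar> \<bar>g x\<bar> powr P" by (rule powr_mult)
      also have "max \<bar>f x\<bar> \<bar>g x\<bar> powr P \<le> \<bar>f x\<bar> powr P + \<bar>g x\<bar> powr P"
        by (simp add: max_def)
      finally show ?case by simp
    qed
    have inth: "integrable ?M (\<lambda>x. \<bar>h x\<bar> powr P)"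
    proof (rule Bochner_Integration.integrable_bound)
      show "integrable ?M (\<lambda>x. 2 powr P * (\<bar>f x\<bar> powr P + \<bar>g x\<bar> powr P))"
        using int by auto
      show "AE x in ?M. norm (\<bar>h x\<bar> powr P) \<le> norm (2 powr P * (\<bar>f x\<bar> powr P + \<bar>g x\<bar> powr P))"
        using pw by eventually_elim auto
    qed (use h in measurable)
    have "(\<integral>x. \<bar>h x\<bar> powr P \<partial>?M) \<le> (\<integral>x. 2 powr P * (\<bar>f x\<bar> powr P + \<bar>g x\<bar> powr P) \<partial>?M)"
      using inth int pw by (intro integral_mono_AE) auto
    also have "\<dots> = 2 powr P * (F powr P + G powr P)"
      using int F G by simp
    also have "\<dots> \<le> 2 powr P * (2 * (F + G) powr P)"
      using FG 2 powr_mono2[of P F "F + G"] powr_mono2[of P G "F + G"] by (intro mult_left_mono) auto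
    also have "\<dots> \<le> 2 powr P * (2 powr P * (F + G) powr P)"
      using 2 powr_mono[of 1 P 2] by (intro mult_left_mono mult_right_mono) auto
    also have "\<dots> = (4 * (F + G)) powr P"
      by (simp flip: powr_mult mult.assoc)
    finally have "(\<integral>x. \<bar>h x\<bar> powr P \<partial>?M) powr (1 / P) \<le> ((4 * (F + G)) powr P) powr (1 / P)"
      using 2 by (intro powr_mono2) auto
    then have "Lp_norm \<Omega> p h \<le> 4 * (F + G)"
      using 2 FG by (simp add: Lp_norm_ennreal powr_powr)
    then show ?thesis using 2 inth h by (simp add: Lp_space_ennreal F_def G_def)
  qed
  then show "h \<in> Lp_space \<Omega> p" "Lp_norm \<Omega> p h \<le> 4 * (Lp_norm \<Omega> p f + Lp_norm \<Omega> p g)" by auto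
qed

lemma Lp_norm_cong_AE:
  assumes "f \<in> borel_measurable (lebesgue_on \<Omega>)" "g \<in> borel_measurable (lebesgue_on \<Omega>)"
    and "AE x in lebesgue_on \<Omega>. f x = g x"
  shows "Lp_norm \<Omega> p f = Lp_norm \<Omega> p g"
proof -
  have "AE x in lebesgue_on \<Omega>. ennreal \<bar>f x\<bar> = ennreal \<bar>g x\<bar>"
    using assms(3) by eventually_elim simp
  then have "esssup (lebesgue_on \<Omega>) (\<lambda>x. ennreal \<bar>f x\<bar>) = esssup (lebesgue_on \<Omega>) (\<lambda>x. ennreal \<bar>g x\<bar>)"
    using assms(1,2) by (intro esssup_AE_cong) auto
  moreover have "(\<integral>x. \<bar>f x\<bar> powr P \<partial>lebesgue_on \<Omega>) = (\<integral>x. \<bar>g x\<bar> powr P \<partial>lebesgue_on \<Omega>)" for P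
    using assms by (intro integral_cong_AE) (auto elim: eventually_mono)
  ultimately show ?thesis by (simp add: Lp_norm_def)
qed

lemma Lp_norm_zero:
  assumes "1 \<le> p" shows "Lp_norm \<Omega> p (\<lambda>x. 0) = 0"
  using assms
proof (cases rule: exponent_cases)
  case 1
  show ?thesis unfolding 1
    using Lp_space_infinity(2)[of "\<lambda>x. 0" \<Omega> 0] by (intro antisym Lp_norm_nonneg) simp
qed (simp add: Lp_norm_ennreal)

text \<open>Completeness of Lebesgue measure. It is wanted because an arbitrarily chosen weak
  derivative is tied to a measurable one only almost everywhere.\<close>

lemma measurable_lebesgue_on_cong_AE:
  fixes f g :: "'a::euclidean_space \<Rightarrow> real"
  assumes "\<Omega> \<in> sets lebesgue" "f \<in> borel_measurable (lebesgue_on \<Omega>)"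
    and "AE x in lebesgue_on \<Omega>. f x = g x"
  shows "g \<in> borel_measurable (lebesgue_on \<Omega>)"
proof -
  have *: "h \<in> borel_measurable (lebesgue_on \<Omega>) \<longleftrightarrow> (\<lambda>x. indicator \<Omega> x *\<^sub>R h x) \<in> borel_measurable lebesgue"
    for h :: "'a \<Rightarrow> real"
    using assms(1) by (intro borel_measurable_restrict_space_iff) simp
  have "AE x in lebesgue. x \<in> \<Omega> \<longrightarrow> f x = g x"
    using assms by (simp add: AE_lebesgue_on_iff)
  then have "AE x in lebesgue. indicator \<Omega> x *\<^sub>R f x = indicator \<Omega> x *\<^sub>R g x"
    by eventually_elim (simp add: indicator_def)
  then show ?thesis using assms(2) unfolding * by (rule borel_measurable_AE[rotated])
qed

section \<open>Hoelder's inequality for functions with support of finite measure\<close>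

lemma powr_le_weighted_mean:
  fixes y \<theta> :: real
  assumes "0 \<le> y" "0 < \<theta>" "\<theta> \<le> 1"
  shows "y powr \<theta> \<le> \<theta> * y + (1 - \<theta>)"
proof (cases "y = 0")
  case False
  then show ?thesis using Youngs_inequality_0[of \<theta> "1 - \<theta>" y 1] assms by simp
qed (use assms in simp)

text \<open>
  Hoelder's inequality, obtained by integrating the weighted arithmetic-geometric mean inequality for
  \<open>\<bar>f\<bar>\<^sup>p\<close> normalised by its mean over \<open>S\<close>.
\<close>

lemma Lyapunov_inequality_on_support:
  fixes f :: "'a \<Rightarrow> real" and p q :: real
  assumes f: "f \<in> borel_measurable M" "integrable M (\<lambda>x. \<bar>f x\<bar> powr p)"
    and S: "S \<in> fmeasurable M" "0 < measure M S" "AE x in M. x \<notin> S \<longrightarrow> f x = 0"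
    and pq: "0 < q" "q \<le> p"
  shows "integrable M (\<lambda>x. \<bar>f x\<bar> powr q)"
    and "(\<integral>x. \<bar>f x\<bar> powr q \<partial>M) \<le> (\<integral>x. \<bar>f x\<bar> powr p \<partial>M) powr (q / p) * measure M S powr (1 - q / p)"
proof -
  define A where "A = (\<integral>x. \<bar>f x\<bar> powr p \<partial>M)"
  define m where "m = measure M S"
  define \<theta> where "\<theta> = q / p"
  have \<theta>: "0 < \<theta>" "\<theta> \<le> 1" using pq by (auto simp: \<theta>_def)
  have m: "0 < m" using S by (simp add: m_def)
  have [measurable]: "f \<in> borel_measurable M" by fact
  have "integrable M (\<lambda>x. \<bar>f x\<bar> powr q) \<and> (\<integral>x. \<bar>f x\<bar> powr q \<partial>M) \<le> A powr \<theta> * m powr (1 - \<theta>)"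
  \<comment> \<open>The normalisation divides by the mean \<open>c\<close>, so A = 0 is treated
    apart; then \<open>f\<close> vanishes almost everywhere.\<close>
  proof (cases "A = 0")
    case True
    then have "AE x in M. \<bar>f x\<bar> powr p = 0"
      using f(2) by (simp add: A_def integral_nonneg_eq_0_iff_AE)
    then have *: "AE x in M. 0 = \<bar>f x\<bar> powr q" by eventually_elim auto
    have "integrable M (\<lambda>x. \<bar>f x\<bar> powr q)"
      by (rule integrable_cong_AE_imp[OF integrable_zero _ *]) measurable
    moreover have "(\<integral>x. \<bar>f x\<bar> powr q \<partial>M) = 0"
      using * by (intro integral_eq_zero_AE) (auto elim: eventually_mono)
    ultimately show ?thesis using True by simp
  next
    case False
    then have A: "0 < A" by (simp add: A_def order_less_le integral_nonneg_AE)
    define c where "c = A / m"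
    have c: "0 < c" using A m by (simp add: c_def)
    let ?g = "\<lambda>x. c powr \<theta> * (\<theta> * (\<bar>f x\<bar> powr p / c) + (1 - \<theta>) * indicator S x)"
    have intS: "integrable M (indicator S :: 'a \<Rightarrow> real)"
      using S(1) by (simp add: integrable_indicator_iff fmeasurable_def)
    have intg: "integrable M ?g" using f(2) intS by simp
    have pw: "AE x in M. \<bar>f x\<bar> powr q \<le> ?g x"
      using S(3)
    proof eventually_elim
      case (elim x)
      show ?case
      proof (cases "x \<in> S")
        case True
        have "\<bar>f x\<bar> powr q = c powr \<theta> * (\<bar>f x\<bar> powr p / c) powr \<theta>"
          using c pq by (simp add: powr_powr \<theta>_def flip: powr_mult)
        also have "\<dots> \<le> c powr \<theta> * (\<theta> * (\<bar>f x\<bar> powr p / c) + (1 - \<theta>))"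
          using \<theta> c by (intro mult_left_mono powr_le_weighted_mean) auto
        finally show ?thesis using True by simp
      next
        case False
        then show ?thesis using elim \<theta> c by simp
      qed
    qed
    have int: "integrable M (\<lambda>x. \<bar>f x\<bar> powr q)"
    proof (rule Bochner_Integration.integrable_bound[OF intg])
      show "AE x in M. norm (\<bar>f x\<bar> powr q) \<le> norm (?g x)"
        using pw by eventually_elim simp
    qed measurable
    have "(\<integral>x. \<bar>f x\<bar> powr q \<partial>M) \<le> (\<integral>x. ?g x \<partial>M)"
      by (intro integral_mono_AE int intg pw)
    also have "\<dots> = c powr \<theta> * (\<theta> * (A / c) + (1 - \<theta>) * m)"
      using f(2) intS fmeasurableD[OF S(1)] by (simp add: A_def m_def)
    \<comment> \<open>By the choice of \<open>c\<close>, A / c = m, so both weights multiply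
      \<open>m\<close> and they add up to 1.\<close>
    also have "\<dots> = c powr \<theta> * m" using A m by (simp add: c_def algebra_simps)
    also have "\<dots> = A powr \<theta> * m powr (1 - \<theta>)"
      using A m by (simp add: c_def powr_divide powr_diff)
    finally show ?thesis using int by simp
  qed
  then show "integrable M (\<lambda>x. \<bar>f x\<bar> powr q)"
    "(\<integral>x. \<bar>f x\<bar> powr q \<partial>M) \<le> (\<integral>x. \<bar>f x\<bar> powr p \<partial>M) powr (q / p) * measure M S powr (1 - q / p)"
    by (auto simp: A_def m_def \<theta>_def)
qed

lemma enn2real_one_divide: "1 \<le> P \<Longrightarrow> enn2real (1 / ennreal P) = 1 / P"
  by (simp add: divide_ennreal flip: ennreal_1)

text \<open>For finite exponents this is the Q-th root of the Lyapunov inequality, since (1 - Q/P)/Q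
  = 1/Q - 1/P. For infinite \<open>p\<close> and finite \<open>q\<close> the essential supremum
  bounds |f| on \<open>S\<close>, and \<open>enn2real (1 / p)\<close> evaluates to 0.\<close>

lemma Lp_norm_le_of_support:
  assumes q: "1 \<le> q" "q \<le> p" and f: "f \<in> Lp_space \<Omega> p"
    and S: "S \<in> lmeasurable" "S \<subseteq> \<Omega>" "\<Omega> \<in> sets lebesgue"
    and supp: "AE x in lebesgue_on \<Omega>. x \<notin> S \<longrightarrow> f x = 0"
  shows "Lp_norm \<Omega> q f \<le> measure lebesgue S powr (enn2real (1 / q) - enn2real (1 / p)) * Lp_norm \<Omega> p f"
proof -
  let ?M = "lebesgue_on \<Omega>" and ?m = "measure lebesgue S"
  have f': "f \<in> borel_measurable ?M" by (rule Lp_space_measurable[OF f])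
  have SM: "measure ?M S = ?m" using S by (simp add: measure_restrict_space)
  have Sf: "S \<in> fmeasurable ?M"
    using S by (auto simp: fmeasurable_def emeasure_restrict_space sets_restrict_space_iff)
  show ?thesis
  proof (cases "?m = 0")
    \<comment> \<open>As \<open>0 powr x\<close> is 0 even for x = 0, the claim for a null set
      \<open>S\<close> demands a vanishing norm also when q = p.\<close>
    case True
    then have "S \<in> null_sets lebesgue"
      using S(1) by (simp add: negligible_iff_measure0 flip: negligible_iff_null_sets)
    then have "AE x in ?M. x \<notin> S"
      using S(3) by (auto simp: AE_lebesgue_on_iff dest: AE_not_in)
    with supp have "AE x in ?M. f x = 0" by eventually_elim simp
    then have "Lp_norm \<Omega> q f = Lp_norm \<Omega> q (\<lambda>x. 0)"
      using f' by (intro Lp_norm_cong_AE) auto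
    then show ?thesis using q True by (simp add: Lp_norm_zero)
  next
    case False
    then have m: "0 < ?m" by (simp add: order_less_le)
    have p: "1 \<le> p" using q by simp
    show ?thesis
      using q(1)
    proof (cases rule: exponent_cases)
      case 1
      then have "p = \<infinity>" using q by (simp add: top_unique)
      then show ?thesis using 1 m by simp
    next
      case (2 Q)
      note Q = this
      show ?thesis using p
      proof (cases rule: exponent_cases)
        case 1
        define B where "B = Lp_norm \<Omega> \<infinity> f"
        have B: "0 \<le> B" by (simp add: B_def Lp_norm_nonneg)
        have "(\<integral>x. \<bar>f x\<bar> powr Q \<partial>?M) \<le> (\<integral>x. B powr Q * indicator S x \<partial>?M)"
        proof (rule integral_mono_AE')
          show "integrable ?M (\<lambda>x. B powr Q * indicator S x)"
            using Sf by (simp add: fmeasurable_def)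
          show "AE x in ?M. \<bar>f x\<bar> powr Q \<le> B powr Q * indicator S x"
            using supp AE_le_Lp_norm_infinity[OF f[unfolded 1]]
          proof eventually_elim
            case (elim x)
            then show ?case using Q B
              by (cases "x \<in> S") (auto simp: B_def intro!: powr_mono2)
          qed
        qed simp
        also have "\<dots> = B powr Q * ?m"
          using SM S(2) by (simp add: Int_absorb2)
        finally have "(\<integral>x. \<bar>f x\<bar> powr Q \<partial>?M) powr (1 / Q) \<le> (B powr Q * ?m) powr (1 / Q)"
          using Q by (intro powr_mono2) auto
        also have "\<dots> = ?m powr (1 / Q) * B"
          using Q B by (simp add: powr_mult powr_powr)
        finally show ?thesis using Q 1 by (simp add: Lp_norm_ennreal enn2real_one_divide B_def)
      next
        case (2 P)
        have QP: "Q \<le> P" using q(2) Q 2 by simp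
        have fP: "integrable ?M (\<lambda>x. \<bar>f x\<bar> powr P)" using f 2 by (simp add: Lp_space_ennreal)
        have "(\<integral>x. \<bar>f x\<bar> powr Q \<partial>?M) \<le> (\<integral>x. \<bar>f x\<bar> powr P \<partial>?M) powr (Q / P) * ?m powr (1 - Q / P)"
          using Lyapunov_inequality_on_support(2)[OF f' fP Sf _ supp _ QP] m Q by (simp add: SM)
        then have "(\<integral>x. \<bar>f x\<bar> powr Q \<partial>?M) powr (1 / Q)
            \<le> ((\<integral>x. \<bar>f x\<bar> powr P \<partial>?M) powr (Q / P) * ?m powr (1 - Q / P)) powr (1 / Q)"
          using Q by (intro powr_mono2) auto
        also have "\<dots> = ?m powr (1 / Q - 1 / P) * (\<integral>x. \<bar>f x\<bar> powr P \<partial>?M) powr (1 / P)"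
        proof -
          have "Q / P * (1 / Q) = 1 / P" "(1 - Q / P) * (1 / Q) = 1 / Q - 1 / P"
            using Q 2 by (simp_all add: field_simps)
          then show ?thesis by (simp only: powr_mult powr_powr mult.commute)
        qed
        finally show ?thesis using Q 2 by (simp add: Lp_norm_ennreal enn2real_one_divide)
      qed
    qed
  qed
qed


subsection \<open>Sobolev norms\<close>

lemma finite_multi_indices: "finite {\<alpha> :: 'd::finite \<Rightarrow> nat. mi_order \<alpha> \<le> m}"
proof (rule finite_subset)
  show "{\<alpha> :: 'd \<Rightarrow> nat. mi_order \<alpha> \<le> m} \<subseteq> PiE UNIV (\<lambda>_. {..m})"
    using member_le_sum[of _ UNIV "_ :: 'd \<Rightarrow> nat"] by (fastforce intro: order_trans)
  show "finite (PiE UNIV (\<lambda>_ :: 'd. {..m}))"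
    by (intro finite_PiE) auto
qed

lemma multi_indices_nonempty: "{\<alpha> :: 'd::finite \<Rightarrow> nat. mi_order \<alpha> \<le> m} \<noteq> {}"
proof -
  have "(\<lambda>_. 0) \<in> {\<alpha> :: 'd \<Rightarrow> nat. mi_order \<alpha> \<le> m}" by simp
  then show ?thesis by blast
qed

lemma multi_indices_eq_nonempty: "{\<alpha> :: 'd::finite \<Rightarrow> nat. mi_order \<alpha> = m} \<noteq> {}"
proof -
  have "(\<lambda>i. if i = undefined then m else 0) \<in> {\<alpha> :: 'd \<Rightarrow> nat. mi_order \<alpha> = m}" by simp
  then show ?thesis by blast
qed

lemma sobolev_norm_over_nonneg:
  assumes "finite A" "A \<noteq> {}"
  shows "0 \<le> sobolev_norm_over A \<Omega> p f"
  using assms by (auto simp: sobolev_norm_over_def Max_ge_iff Lp_norm_nonneg)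

lemma sobolev_norm_nonneg: "0 \<le> sobolev_norm \<Omega> m p f"
  unfolding sobolev_norm_def
  by (rule sobolev_norm_over_nonneg[OF finite_multi_indices multi_indices_nonempty])

lemma sobolev_seminorm_nonneg: "0 \<le> sobolev_seminorm \<Omega> m p f"
  unfolding sobolev_seminorm_def
  by (rule sobolev_norm_over_nonneg[OF finite_subset[OF _ finite_multi_indices[of m]] multi_indices_eq_nonempty]) auto

lemma Lp_norm_le_sobolev_norm:
  assumes "1 \<le> p" "mi_order \<alpha> \<le> m"
  shows "Lp_norm \<Omega> p (weak_deriv \<Omega> \<alpha> f) \<le> sobolev_norm \<Omega> m p f"
  using assms(1)
proof (cases rule: exponent_cases)
  case 1
  then show ?thesis
    using assms(2) finite_multi_indices
    by (auto simp: sobolev_norm_def sobolev_norm_over_def intro!: Max_ge)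
next
  case (2 P)
  let ?D = "\<lambda>\<alpha>. Lp_norm \<Omega> p (weak_deriv \<Omega> \<alpha> f)"
  have "?D \<alpha> powr P \<le> (\<Sum>\<alpha> | mi_order \<alpha> \<le> m. ?D \<alpha> powr P)"
    using assms(2) finite_multi_indices by (intro member_le_sum) auto
  then have "(?D \<alpha> powr P) powr (1 / P) \<le> (\<Sum>\<alpha> | mi_order \<alpha> \<le> m. ?D \<alpha> powr P) powr (1 / P)"
    using 2 by (intro powr_mono2) auto
  then show ?thesis
    using 2 by (simp add: sobolev_norm_def sobolev_norm_over_def powr_powr Lp_norm_nonneg)
qed

text \<open>The dimension enters only through the type, hence the \<open>itself\<close> argument.
  This count is the crude factor between the largest derivative norm and the full norm, valid for
  every exponent.\<close>

definition mi_card :: "'d::finite itself \<Rightarrow> nat \<Rightarrow> real" where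
  "mi_card _ m = real (card {\<alpha> :: 'd \<Rightarrow> nat. mi_order \<alpha> \<le> m})"

lemma mi_card_ge_1: "1 \<le> mi_card TYPE('d::finite) m"
proof -
  have "0 < card {\<alpha> :: 'd \<Rightarrow> nat. mi_order \<alpha> \<le> m}"
    by (simp only: card_gt_0_iff multi_indices_nonempty finite_multi_indices) simp
  then show ?thesis by (simp add: mi_card_def)
qed

text \<open>For a finite exponent the natural factor is the (1/P)-th power of the count, which is at
  most the count itself because the count is at least 1. Together with
  \<open>Lp_norm_le_sobolev_norm\<close> this lets norm estimates be proved one derivative at a
  time.\<close>

lemma sobolev_norm_le:
  fixes f :: "real^'d \<Rightarrow> real"
  assumes "1 \<le> p" and B: "\<And>\<alpha>. mi_order \<alpha> \<le> m \<Longrightarrow> Lp_norm \<Omega> p (weak_deriv \<Omega> \<alpha> f) \<le> B"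
  shows "sobolev_norm \<Omega> m p f \<le> mi_card TYPE('d) m * B"
proof -
  let ?A = "{\<alpha> :: 'd \<Rightarrow> nat. mi_order \<alpha> \<le> m}"
  have B0: "0 \<le> B" using B[of "\<lambda>_. 0"] Lp_norm_nonneg by (auto intro: order_trans)
  have card: "1 \<le> mi_card TYPE('d) m" by (rule mi_card_ge_1)
  show ?thesis
    using assms(1)
  proof (cases rule: exponent_cases)
    case 1
    have "sobolev_norm \<Omega> m p f \<le> B"
      unfolding sobolev_norm_def sobolev_norm_over_def if_P[OF 1]
    proof (rule Max.boundedI)
      show "finite ((\<lambda>\<alpha>. Lp_norm \<Omega> p (weak_deriv \<Omega> \<alpha> f)) ` ?A)"
        by (intro finite_imageI finite_multi_indices)
      show "(\<lambda>\<alpha>. Lp_norm \<Omega> p (weak_deriv \<Omega> \<alpha> f)) ` ?A \<noteq> {}"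
        using multi_indices_nonempty by blast
      show "y \<le> B" if "y \<in> (\<lambda>\<alpha>. Lp_norm \<Omega> p (weak_deriv \<Omega> \<alpha> f)) ` ?A" for y
        using that B by blast
    qed
    also have "\<dots> \<le> mi_card TYPE('d) m * B" using mult_right_mono[OF card B0] by simp
    finally show ?thesis .
  next
    case (2 P)
    have "(\<Sum>\<alpha>\<in>?A. Lp_norm \<Omega> p (weak_deriv \<Omega> \<alpha> f) powr P) \<le> (\<Sum>\<alpha>\<in>?A. B powr P)"
      using B 2 by (intro sum_mono powr_mono2 Lp_norm_nonneg) auto
    then have "(\<Sum>\<alpha>\<in>?A. Lp_norm \<Omega> p (weak_deriv \<Omega> \<alpha> f) powr P) powr (1 / P)
        \<le> (mi_card TYPE('d) m * B powr P) powr (1 / P)"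
      using 2 by (intro powr_mono2 sum_nonneg) (auto simp: mi_card_def)
    also have "\<dots> = mi_card TYPE('d) m powr (1 / P) * B"
      using 2 B0 by (simp add: powr_mult powr_powr)
    also have "\<dots> \<le> mi_card TYPE('d) m powr 1 * B"
      using 2 B0 card by (intro mult_right_mono powr_mono) auto
    finally show ?thesis
      using 2 card by (simp add: sobolev_norm_def sobolev_norm_over_def)
  qed
qed

text \<open>The choice operator need not return the witness that lies in the Lebesgue space. By
  uniqueness the two agree almost everywhere, and membership passes over by domination.\<close>

lemma sobolev_space_weak_deriv:
  assumes "open \<Omega>" "1 \<le> p" "f \<in> sobolev_space \<Omega> m p" "mi_order \<alpha> \<le> m"
  shows "has_weak_deriv \<Omega> \<alpha> f (weak_deriv \<Omega> \<alpha> f)" and "weak_deriv \<Omega> \<alpha> f \<in> Lp_space \<Omega> p"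
proof -
  obtain g where g: "g \<in> Lp_space \<Omega> p" "has_weak_deriv \<Omega> \<alpha> f g"
    using assms(3,4) unfolding sobolev_space_def by blast
  from g(2) show *: "has_weak_deriv \<Omega> \<alpha> f (weak_deriv \<Omega> \<alpha> f)"
    unfolding weak_deriv_def by (rule someI[of "has_weak_deriv \<Omega> \<alpha> f"])
  have AE: "AE x in lebesgue_on \<Omega>. g x = weak_deriv \<Omega> \<alpha> f x"
    by (rule has_weak_deriv_unique[OF assms(1) g(2) *])
  show "weak_deriv \<Omega> \<alpha> f \<in> Lp_space \<Omega> p"
  proof (rule Lp_quasi_triangle(1)[OF assms(2) g(1) g(1)])
    show "weak_deriv \<Omega> \<alpha> f \<in> borel_measurable (lebesgue_on \<Omega>)"
      using assms(1) by (intro measurable_lebesgue_on_cong_AE[OF _ Lp_space_measurable[OF g(1)] AE]) simp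
    show "AE x in lebesgue_on \<Omega>. \<bar>weak_deriv \<Omega> \<alpha> f x\<bar> \<le> \<bar>g x\<bar> + \<bar>g x\<bar>"
      using AE by eventually_elim simp
  qed
qed

text \<open>The representative chosen for the derivative of f - g need not be the difference of the
  chosen representatives; it equals it almost everywhere, by linearity and uniqueness.\<close>

lemma sobolev_space_diff:
  fixes f g :: "real^'d \<Rightarrow> real"
  assumes "open \<Omega>" "1 \<le> p" and f: "f \<in> sobolev_space \<Omega> m p" and g: "g \<in> sobolev_space \<Omega> m p"
  shows "f - g \<in> sobolev_space \<Omega> m p"
    and "sobolev_norm \<Omega> m p (f - g)
      \<le> 4 * mi_card TYPE('d) m * (sobolev_norm \<Omega> m p f + sobolev_norm \<Omega> m p g)"
proof -
  have fg: "f - g = (\<lambda>x. 1 * f x + (- 1) * g x)" by (rule ext) simp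
  have wd: "has_weak_deriv \<Omega> \<alpha> (f - g) (\<lambda>x. 1 * weak_deriv \<Omega> \<alpha> f x + (- 1) * weak_deriv \<Omega> \<alpha> g x)"
    and Lp: "(\<lambda>x. 1 * weak_deriv \<Omega> \<alpha> f x + (- 1) * weak_deriv \<Omega> \<alpha> g x) \<in> Lp_space \<Omega> p"
    if "mi_order \<alpha> \<le> m" for \<alpha>
  proof -
    note D = sobolev_space_weak_deriv[OF assms(1,2) f that] sobolev_space_weak_deriv[OF assms(1,2) g that]
    show "has_weak_deriv \<Omega> \<alpha> (f - g) (\<lambda>x. 1 * weak_deriv \<Omega> \<alpha> f x + (- 1) * weak_deriv \<Omega> \<alpha> g x)"
      unfolding fg by (rule has_weak_deriv_linear[OF assms(1) D(1,3)])
    show "(\<lambda>x. 1 * weak_deriv \<Omega> \<alpha> f x + (- 1) * weak_deriv \<Omega> \<alpha> g x) \<in> Lp_space \<Omega> p"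
      using D(2,4)[THEN Lp_space_measurable]
      by (intro Lp_quasi_triangle(1)[OF assms(2) D(2,4)]) auto
  qed
  have fgp: "f \<in> Lp_space \<Omega> p" "g \<in> Lp_space \<Omega> p"
    using f g unfolding sobolev_space_def by blast+
  then have "f - g \<in> Lp_space \<Omega> p"
    using fgp[THEN Lp_space_measurable] unfolding fg
    by (intro Lp_quasi_triangle(1)[OF assms(2) fgp]) auto
  then show W: "f - g \<in> sobolev_space \<Omega> m p"
    using wd Lp unfolding sobolev_space_def by blast
  have "sobolev_norm \<Omega> m p (f - g)
      \<le> mi_card TYPE('d) m * (4 * (sobolev_norm \<Omega> m p f + sobolev_norm \<Omega> m p g))"
  proof (rule sobolev_norm_le[OF assms(2)])
    fix \<alpha> :: "'d \<Rightarrow> nat" assume \<alpha>: "mi_order \<alpha> \<le> m"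
    note D = sobolev_space_weak_deriv[OF assms(1,2) f \<alpha>] sobolev_space_weak_deriv[OF assms(1,2) g \<alpha>]
      sobolev_space_weak_deriv[OF assms(1,2) W \<alpha>]
    have "AE x in lebesgue_on \<Omega>. \<bar>weak_deriv \<Omega> \<alpha> (f - g) x\<bar> \<le> \<bar>weak_deriv \<Omega> \<alpha> f x\<bar> + \<bar>weak_deriv \<Omega> \<alpha> g x\<bar>"
      using has_weak_deriv_unique[OF assms(1) D(5) wd[OF \<alpha>]] by eventually_elim simp
    then have "Lp_norm \<Omega> p (weak_deriv \<Omega> \<alpha> (f - g))
        \<le> 4 * (Lp_norm \<Omega> p (weak_deriv \<Omega> \<alpha> f) + Lp_norm \<Omega> p (weak_deriv \<Omega> \<alpha> g))"
      by (rule Lp_quasi_triangle(2)[OF assms(2) D(2,4) Lp_space_measurable[OF D(6)]])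
    also have "\<dots> \<le> 4 * (sobolev_norm \<Omega> m p f + sobolev_norm \<Omega> m p g)"
      using Lp_norm_le_sobolev_norm[OF assms(2) \<alpha>] by (intro mult_left_mono add_mono) auto
    finally show "Lp_norm \<Omega> p (weak_deriv \<Omega> \<alpha> (f - g))
        \<le> 4 * (sobolev_norm \<Omega> m p f + sobolev_norm \<Omega> m p g)" .
  qed
  then show "sobolev_norm \<Omega> m p (f - g)
      \<le> 4 * mi_card TYPE('d) m * (sobolev_norm \<Omega> m p f + sobolev_norm \<Omega> m p g)"
    by (simp add: mult_ac)
qed

lemma sobolev_space_mono: "n \<le> m \<Longrightarrow> sobolev_space \<Omega> m p \<subseteq> sobolev_space \<Omega> n p"
  unfolding sobolev_space_def using order_trans by blast

text \<open>Locality makes all derivatives up to order \<open>m\<close> vanish off \<open>S\<close>,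
  so the Lebesgue estimate applies to each. The main proof uses it twice: with the essential support
  of e - w for the power of h, and with S = \<Omega> for passing from \<eta> to q.\<close>

lemma sobolev_norm_le_of_support:
  fixes f :: "real^'d \<Rightarrow> real"
  assumes "open \<Omega>" "1 \<le> q" "q \<le> p" and f: "f \<in> sobolev_space \<Omega> m p"
    and S: "S \<in> lmeasurable" "S \<subseteq> \<Omega>" "ess_support \<Omega> f \<subseteq> S"
  shows "sobolev_norm \<Omega> m q f \<le> mi_card TYPE('d) m *
    (measure lebesgue S powr (enn2real (1 / q) - enn2real (1 / p)) * sobolev_norm \<Omega> m p f)"
proof (rule sobolev_norm_le[OF assms(2)])
  fix \<alpha> :: "'d \<Rightarrow> nat" assume \<alpha>: "mi_order \<alpha> \<le> m"
  have p: "1 \<le> p" using assms(2,3) by simp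
  note D = sobolev_space_weak_deriv[OF assms(1) p f \<alpha>]
  have "AE x in lebesgue_on \<Omega>. x \<notin> S \<longrightarrow> weak_deriv \<Omega> \<alpha> f x = 0"
    using weak_deriv_AE_zero_off_ess_support[OF assms(1) D(1)] by eventually_elim (use S(3) in blast)
  then have "Lp_norm \<Omega> q (weak_deriv \<Omega> \<alpha> f)
      \<le> measure lebesgue S powr (enn2real (1 / q) - enn2real (1 / p)) * Lp_norm \<Omega> p (weak_deriv \<Omega> \<alpha> f)"
    using assms(1) by (intro Lp_norm_le_of_support[OF assms(2,3) D(2) S(1,2)]) auto
  also have "\<dots> \<le> measure lebesgue S powr (enn2real (1 / q) - enn2real (1 / p)) * sobolev_norm \<Omega> m p f"
    by (intro mult_left_mono Lp_norm_le_sobolev_norm p \<alpha>) simp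
  finally show "Lp_norm \<Omega> q (weak_deriv \<Omega> \<alpha> f)
      \<le> measure lebesgue S powr (enn2real (1 / q) - enn2real (1 / p)) * sobolev_norm \<Omega> m p f" .
qed

lemma ess_support_subset: "ess_support \<Omega> f \<subseteq> \<Omega>"
  by (auto simp: ess_support_def)

lemma ess_support_lmeasurable:
  assumes "open \<Omega>" "bounded \<Omega>"
  shows "ess_support \<Omega> f \<in> lmeasurable"
proof -
  have "ess_support \<Omega> f = \<Omega> - (\<Omega> - ess_support \<Omega> f)"
    using ess_support_subset by auto
  also have "\<dots> \<in> lmeasurable"
    using assms ess_support_complement_AE(1)[OF assms(1)]
    by (intro fmeasurable.Diff lmeasurable_open) (auto intro: bounded_subset)
  finally show ?thesis .
qed

text \<open>The support condition on \<open>\<pi>h\<close> concerns w - e, the energy argument e -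
  w.\<close>

lemma ess_support_minus_commute: "ess_support \<Omega> (f - g) = ess_support \<Omega> (g - f)"
proof -
  have "(f - g) x = 0 \<longleftrightarrow> (g - f) x = 0" for x by auto
  then show ?thesis unfolding ess_support_def by presburger
qed


subsection \<open>Comparison of the two projectors\<close>

lemma bilinear_form_on_diff:
  assumes b: "bilinear_form_on V b" and V: "subspace V" and uvw: "u \<in> V" "v \<in> V" "w \<in> V"
  shows "b (u - v) w = b u w - b v w" and "b w (u - v) = b w u - b w v"
proof -
  have neg: "(- 1) *\<^sub>R v \<in> V" by (rule subspace_scale[OF V uvw(2)])
  have *: "b ((- 1) *\<^sub>R v) w = (- 1) * b v w" "b w ((- 1) *\<^sub>R v) = (- 1) * b w v"
    using b uvw unfolding bilinear_form_on_def by blast+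
  have "b (u + (- 1) *\<^sub>R v) w = b u w + b ((- 1) *\<^sub>R v) w"
    "b w (u + (- 1) *\<^sub>R v) = b w u + b w ((- 1) *\<^sub>R v)"
    using b uvw neg unfolding bilinear_form_on_def by blast+
  then show "b (u - v) w = b u w - b v w" "b w (u - v) = b w u - b w v"
    using * by simp_all
qed

text \<open>
  Testing with \<open>w\<close> in the common subspace makes both Galerkin orthogonalities available, so only the
  consistency error of the two forms and the distance of the difference to \<open>w\<close> remain.
\<close>

lemma projector_difference_estimate:
  assumes V: "subspace V" and a: "bilinear_form_on V a" and a': "bilinear_form_on V a'"
    and cc: "coercive_continuous \<Omega> s V \<kappa> M a'"
    and r: "is_projector V W a r" and r': "is_projector V W' a' r'"
    and W: "W \<subseteq> V" "W' \<subseteq> V" and u: "u \<in> V" and w: "w \<in> W' \<inter> W"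
  defines "e \<equiv> r' u - r u"
  shows "\<kappa> * (sobolev_norm \<Omega> s 2 e)\<^sup>2 \<le> M * sobolev_norm \<Omega> s 2 e * sobolev_norm \<Omega> s 2 (e - w)
    + (a (r u - u) w - a' (r u - u) w)"
proof -
  have mem: "r u \<in> V" "r' u \<in> V" "w \<in> V" using r r' W u w by (auto simp: is_projector_def)
  have ru: "r u - u \<in> V" "r' u - u \<in> V" and e: "e \<in> V" and ew: "e - w \<in> V"
    using V mem u by (auto simp: e_def intro!: subspace_diff)
  have orth: "a (r u - u) w = 0" "a' (r' u - u) w = 0"
    using r r' u w by (auto simp: is_projector_def)
  have "e = (r' u - u) - (r u - u)" by (simp add: e_def)
  then have "a' e w = - a' (r u - u) w"
    using bilinear_form_on_diff(1)[OF a' V ru(2,1) mem(3)] orth by simp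
  moreover have "a' e (e - w) = a' e e - a' e w"
    by (rule bilinear_form_on_diff(2)[OF a' V e mem(3) e])
  moreover have "a' e (e - w) \<le> M * sobolev_norm \<Omega> s 2 e * sobolev_norm \<Omega> s 2 (e - w)"
    "\<kappa> * (sobolev_norm \<Omega> s 2 e)\<^sup>2 \<le> a' e e"
    using cc e ew by (auto simp: coercive_continuous_def)
  ultimately show ?thesis using orth by simp
qed

text \<open>With z = M X / \<kappa> and y = Y / sqrt \<kappa>, x > z + y would make both
  \<open>x\<close> and x - z exceed \<open>y\<close>, so that x (x - z) > y^2; multiplied by
  \<kappa>, this contradicts the hypothesis.\<close>

lemma quadratic_inequality_bound:
  fixes x :: real
  assumes "0 < \<kappa>" "0 \<le> M" "0 \<le> X" "0 \<le> Y" and le: "\<kappa> * x\<^sup>2 \<le> M * x * X + Y\<^sup>2"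
  shows "x \<le> M / \<kappa> * X + Y / sqrt \<kappa>"
proof (rule ccontr)
  assume "\<not> ?thesis"
  then have x: "M / \<kappa> * X + Y / sqrt \<kappa> < x" by simp
  define y where "y = Y / sqrt \<kappa>"
  define z where "z = M / \<kappa> * X"
  have y: "0 \<le> y" "\<kappa> * y\<^sup>2 = Y\<^sup>2" and z: "0 \<le> z" "\<kappa> * z = M * X"
    using assms by (auto simp: y_def z_def power_divide)
  have "y * y < x * (x - z)"
    using x y z by (intro mult_strict_mono') (auto simp: y_def z_def)
  then have "\<kappa> * (y * y) < \<kappa> * (x * (x - z))"
    using assms(1) by (rule mult_strict_left_mono)
  also have "\<dots> = \<kappa> * x\<^sup>2 - x * (\<kappa> * z)" by (simp add: power2_eq_square algebra_simps)
  also have "\<dots> \<le> Y\<^sup>2" using le z by (simp add: mult_ac)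
  finally show False using y by (simp add: power2_eq_square)
qed

text \<open>Since \<open>h0\<close> may exceed 1, a larger exponent need not give a smaller power;
  the factor \<open>h0 powr (b - a)\<close> compensates.\<close>

lemma powr_le_const_mult_powr:
  fixes h h0 :: real
  assumes "0 < h" "h \<le> h0" "a \<le> b"
  shows "h powr b \<le> h0 powr (b - a) * h powr a"
proof -
  have "h powr b = h powr (b - a) * h powr a" by (simp flip: powr_add)
  also have "\<dots> \<le> h0 powr (b - a) * h powr a"
    using assms by (intro mult_right_mono powr_mono2) auto
  finally show ?thesis .
qed

theorem corollary2p3:
  fixes \<Omega> :: "(real^'d) set"
    and s r \<mu> \<nu> :: nat
    and V :: "(real^'d \<Rightarrow> real) set"
    and h0 \<gamma> \<delta> C1 :: real
    and \<eta> q :: ennreal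
    and a a_plus :: "real \<Rightarrow> (real^'d \<Rightarrow> real) \<Rightarrow> (real^'d \<Rightarrow> real) \<Rightarrow> real"
    and Vh Vh_plus :: "real \<Rightarrow> (real^'d \<Rightarrow> real) set"
    and rh rh_plus \<pi>h :: "real \<Rightarrow> (real^'d \<Rightarrow> real) \<Rightarrow> (real^'d \<Rightarrow> real)"
    and l :: "real \<Rightarrow> real"
  assumes domain: "open \<Omega>" "bounded \<Omega>" "lipschitz_domain \<Omega>"
    and V: "closed_sobolev_subspace \<Omega> s V"
    and h0: "h0 > 0"
    and bilinear: "\<forall>h\<in>{0<..h0}. bilinear_form_on V (a h) \<and> bilinear_form_on V (a_plus h)"
    and coercive_continuous:
      "\<exists>\<kappa>>0. \<exists>M>0. \<forall>h\<in>{0<..h0}.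
         coercive_continuous \<Omega> s V \<kappa> M (a h) \<and> coercive_continuous \<Omega> s V \<kappa> M (a_plus h)"
    and fe_spaces:
      "\<forall>h\<in>{0<..h0}. finite_dim_subspace \<Omega> V (Vh h) \<and> finite_dim_subspace \<Omega> V (Vh_plus h)"
    and projectors:
      "\<forall>h\<in>{0<..h0}. is_projector V (Vh h) (a h) (rh h) \<and>
                      is_projector V (Vh_plus h) (a_plus h) (rh_plus h)"
    and \<eta>: "2 \<le> \<eta>"
    and cond_i:
      "\<forall>h\<in>{0<..h0}. Vh h \<subseteq> sobolev_space \<Omega> s \<eta> \<inter> V \<and> Vh_plus h \<subseteq> sobolev_space \<Omega> s \<eta> \<inter> V"
    and cond_ii:
      "\<exists>C>0. \<forall>h\<in>{0<..h0}. \<forall>m\<le>s. \<forall>w \<in> Vh_plus h \<inter> Vh h.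
         sobolev_norm \<Omega> m \<eta> w \<le> C * h powr (- real m) * sobolev_norm \<Omega> 0 \<eta> w"
    and \<gamma>: "\<gamma> \<ge> 0"
    and cond_iii:
      "\<exists>C>0. \<forall>h\<in>{0<..h0}. \<forall>w \<in> Vh_plus h + Vh h.
         \<pi>h h w \<in> Vh_plus h \<inter> Vh h \<and>
         sobolev_norm \<Omega> 0 \<eta> (\<pi>h h w) \<le> C * sobolev_norm \<Omega> 0 \<eta> w \<and>
         measure lebesgue (ess_support \<Omega> (\<pi>h h w - w)) \<le> C * h powr \<gamma>"
    and form_params: "C1 > 0" "\<delta> \<ge> 0" "1 \<le> q" "q \<le> \<eta>" "\<mu> \<le> s" "\<nu> \<le> s"
    and form_diff:
      "\<forall>h\<in>{0<..h0}. \<forall>v \<in> sobolev_space \<Omega> s \<eta> \<inter> V. \<forall>w \<in> sobolev_space \<Omega> s \<eta> \<inter> V.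
         \<bar>a_plus h v w - a h v w\<bar> \<le>
           C1 * h powr \<delta> * sobolev_norm \<Omega> \<mu> \<eta> v * sobolev_norm \<Omega> \<nu> q w"
    and r: "r > s"
    and l: "l = (\<lambda>h. 1) \<or> (l = (\<lambda>h. ln (inverse h)) \<and> h0 < 1)"
    and error_0:
      "\<exists>C>0. \<forall>h\<in>{0<..h0}. \<forall>u \<in> sobolev_space \<Omega> r \<eta> \<inter> V.
         sobolev_norm \<Omega> 0 \<eta> (rh h u - u) + sobolev_norm \<Omega> 0 \<eta> (rh_plus h u - u)
           \<le> C * l h * h powr real r * sobolev_seminorm \<Omega> r \<eta> u"
    and error_m:
      "\<exists>C>0. \<forall>h\<in>{0<..h0}. \<forall>u \<in> sobolev_space \<Omega> r \<eta> \<inter> V. \<forall>m\<in>{1..s}.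
         sobolev_norm \<Omega> m \<eta> (rh h u - u) + sobolev_norm \<Omega> m \<eta> (rh_plus h u - u)
           \<le> C * h powr (real r - real m) * sobolev_seminorm \<Omega> r \<eta> u"
  shows
    "(\<exists>C>0. \<forall>h\<in>{0<..h0}. \<forall>u \<in> sobolev_space \<Omega> r \<eta> \<inter> V.
        sobolev_norm \<Omega> s 2 (rh_plus h u - rh h u)
          \<le> C * l h * h powr (real r - real s +
                min (\<gamma> * (1/2 - enn2real (1 / \<eta>)))
                    ((\<delta> + 2 * real s - real \<mu> - real \<nu>) / 2))
            * sobolev_seminorm \<Omega> r \<eta> u) \<and>
     ((\<forall>h\<in>{0<..h0}. \<forall>v\<in>V. \<forall>w\<in>V. a h v w = a_plus h v w) \<longrightarrow>
      (\<exists>C>0. \<forall>h\<in>{0<..h0}. \<forall>u \<in> sobolev_space \<Omega> r \<eta> \<inter> V.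
        sobolev_norm \<Omega> s 2 (rh_plus h u - rh h u)
          \<le> C * l h * h powr (real r - real s + \<gamma> * (1/2 - enn2real (1 / \<eta>)))
            * sobolev_seminorm \<Omega> r \<eta> u))"
proof -
  define K where "K = (\<lambda>m. mi_card TYPE('d) m)"
  define N where "N = sobolev_norm \<Omega>"
  define U where "U = sobolev_seminorm \<Omega> r \<eta>"
  define \<theta> where "\<theta> = 1/2 - enn2real (1 / \<eta>)"
  define \<tau> where "\<tau> = (\<delta> + 2 * real s - real \<mu> - real \<nu>) / 2"
  have \<eta>1: "1 \<le> \<eta>"
    by (rule order_trans[OF _ \<eta>]) simp
  have Vsub: "subspace V" using V by (simp add: closed_sobolev_subspace_def)
  have K1: "1 \<le> K m" for m unfolding K_def by (rule mi_card_ge_1)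
  have N0: "0 \<le> N m p f" for m p f unfolding N_def by (rule sobolev_norm_nonneg)
  have U0: "0 \<le> U u" for u unfolding U_def by (rule sobolev_seminorm_nonneg)
  have half: "enn2real (1 / (2::ennreal)) = 1/2" using enn2real_one_divide[of 2] by simp
  \<comment> \<open>Inserting a bound for the measure of the support needs monotonicity of
    \<open>x powr \<theta>\<close> in x, which rests on this sign.\<close>
  have \<theta>0: "0 \<le> \<theta>"
    using \<eta>1
  proof (cases rule: exponent_cases)
    case (2 P)
    then have "2 \<le> P" using \<eta> by (simp flip: ennreal_numeral)
    then show ?thesis using 2 by (simp add: \<theta>_def enn2real_one_divide field_simps)
  qed (simp add: \<theta>_def)
  \<comment> \<open>The bounds of positive order carry no factor \<open>l h\<close>; inserting it
    requires \<open>l\<close> to stay away from 0. In the logarithmic case its least value ln(1/h0)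
    is positive because h0 < 1.\<close>
  obtain L where L: "0 < L" "\<And>h. h \<in> {0<..h0} \<Longrightarrow> 1 \<le> L * l h" and l0: "\<And>h. h \<in> {0<..h0} \<Longrightarrow> 0 < l h"
  proof (cases "l = (\<lambda>h. 1)")
    case True
    then show ?thesis using that[of 1] by simp
  next
    case False
    then have lh: "l = (\<lambda>h. ln (inverse h))" "h0 < 1" using l by auto
    have ln: "0 < ln (inverse h0)" using h0 lh by (simp add: one_less_inverse)
    have le: "ln (inverse h0) \<le> l h" if "h \<in> {0<..h0}" for h
      using that h0 by (simp add: lh)
    have "1 \<le> 1 / ln (inverse h0) * l h" if "h \<in> {0<..h0}" for h
      using le[OF that] ln by (simp add: field_simps)
    moreover have "0 < l h" if "h \<in> {0<..h0}" for h
      using le[OF that] ln by linarith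
    ultimately show ?thesis using that[of "1 / ln (inverse h0)"] ln by simp
  qed
  obtain \<kappa> M where \<kappa>M: "0 < \<kappa>" "0 < M"
    and cc: "\<And>h. h \<in> {0<..h0} \<Longrightarrow> coercive_continuous \<Omega> s V \<kappa> M (a_plus h)"
    using coercive_continuous by blast
  obtain C2 where C2: "0 < C2" "\<And>h m w. h \<in> {0<..h0} \<Longrightarrow> m \<le> s \<Longrightarrow> w \<in> Vh_plus h \<inter> Vh h \<Longrightarrow>
      N m \<eta> w \<le> C2 * h powr (- real m) * N 0 \<eta> w"
    using cond_ii unfolding N_def by blast
  obtain C3 where C3: "0 < C3" "\<And>h w. h \<in> {0<..h0} \<Longrightarrow> w \<in> Vh_plus h + Vh h \<Longrightarrow>
      \<pi>h h w \<in> Vh_plus h \<inter> Vh h \<and> N 0 \<eta> (\<pi>h h w) \<le> C3 * N 0 \<eta> w \<and>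
      measure lebesgue (ess_support \<Omega> (\<pi>h h w - w)) \<le> C3 * h powr \<gamma>"
    using cond_iii unfolding N_def by blast
  obtain C0 where C0: "0 < C0" "\<And>h u. h \<in> {0<..h0} \<Longrightarrow> u \<in> sobolev_space \<Omega> r \<eta> \<inter> V \<Longrightarrow>
      N 0 \<eta> (rh h u - u) + N 0 \<eta> (rh_plus h u - u) \<le> C0 * l h * h powr real r * U u"
    using error_0 unfolding N_def U_def by blast
  obtain Cm where Cm: "0 < Cm" "\<And>h u m. h \<in> {0<..h0} \<Longrightarrow> u \<in> sobolev_space \<Omega> r \<eta> \<inter> V \<Longrightarrow> m \<in> {1..s} \<Longrightarrow>
      N m \<eta> (rh h u - u) + N m \<eta> (rh_plus h u - u) \<le> Cm * h powr (real r - real m) * U u"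
    using error_m unfolding N_def U_def by blast
  \<comment> \<open>One constant for all orders up to \<open>s\<close>: order 0 uses
    \<open>C0\<close>, and for positive order 1 \<le> L * l h brings in the factor
    \<open>l h\<close>.\<close>
  define E where "E = C0 + Cm * L"
  have E0: "0 < E" using C0 Cm L by (simp add: E_def add_pos_pos)
  have err: "N m \<eta> (rh h u - u) + N m \<eta> (rh_plus h u - u) \<le> E * l h * h powr (real r - real m) * U u"
    if "h \<in> {0<..h0}" "u \<in> sobolev_space \<Omega> r \<eta> \<inter> V" "m \<le> s" for h u m
  proof (cases "m = 0")
    case True
    have "C0 * (l h * h powr real r * U u) \<le> E * (l h * h powr real r * U u)"
      using Cm L l0[OF that(1)] U0[of u] by (intro mult_right_mono) (auto simp: E_def)
    then show ?thesis using C0(2)[OF that(1,2)] True by (simp add: mult.assoc)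
  next
    case False
    have "Cm * (h powr (real r - real m) * U u) * 1 \<le> Cm * (h powr (real r - real m) * U u) * (L * l h)"
      using L(2)[OF that(1)] Cm(1) U0[of u] by (intro mult_left_mono) auto
    also have "\<dots> = Cm * L * (l h * h powr (real r - real m) * U u)" by simp
    also have "\<dots> \<le> E * (l h * h powr (real r - real m) * U u)"
      using C0 l0[OF that(1)] U0[of u] by (intro mult_right_mono) (auto simp: E_def)
    finally show ?thesis using Cm(2)[OF that(1,2), of m] that(3) False by (simp add: mult.assoc)
  qed
  \<comment> \<open>The constants belong to successive bounds: \<open>D0\<close> to \<open>e\<close>
    in order 0, \<open>Dw\<close> to \<open>w\<close> in all orders, \<open>Ds\<close> to e - w in
    the \<eta>-norm of order s, \<open>D2\<close> to e - w in the 2-norm, \<open>D4\<close> to the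
    consistency error.\<close>
  define D0 where "D0 = 4 * K 0 * E"
  define Dw where "Dw = C2 * C3 * D0"
  define Ds where "Ds = 4 * K s * (4 * K s * E + Dw)"
  define D2 where "D2 = K s * C3 powr \<theta> * Ds"
  define mq where "mq = measure lebesgue \<Omega> powr (enn2real (1 / q) - enn2real (1 / \<eta>))"
  define D4 where "D4 = C1 * E * (K \<nu> * mq * Dw)"
  have pos: "0 \<le> D0" "0 \<le> Dw" "0 \<le> Ds" "0 \<le> D2" "0 \<le> D4" "0 \<le> mq"
    using K1[of 0] K1[of s] K1[of \<nu>] E0 C2 C3 form_params
    by (auto simp: D0_def Dw_def Ds_def D2_def D4_def mq_def)
  \<comment> \<open>\<open>Z\<close> is the consistency error. Leaving it abstract lets one estimate
    serve both conclusions: in general it is at most a square, and for coinciding forms it is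
    0.\<close>
  have core: "\<exists>Z. \<kappa> * (N s 2 (rh_plus h u - rh h u))\<^sup>2
        \<le> M * N s 2 (rh_plus h u - rh h u) * (D2 * l h * h powr (real r - real s + \<gamma> * \<theta>) * U u) + Z
      \<and> Z \<le> (sqrt D4 * l h * h powr (real r - real s + \<tau>) * U u)\<^sup>2
      \<and> ((\<forall>h\<in>{0<..h0}. \<forall>v\<in>V. \<forall>w\<in>V. a h v w = a_plus h v w) \<longrightarrow> Z = 0)"
    if h: "h \<in> {0<..h0}" and u: "u \<in> sobolev_space \<Omega> r \<eta> \<inter> V" for h u
  proof -
    define e where "e = rh_plus h u - rh h u"
    define w where "w = \<pi>h h e"
    define Z where "Z = a h (rh h u - u) w - a_plus h (rh h u - u) w"
    have hp: "0 < h" and lp: "0 < l h" using h l0 by auto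
    have proj: "is_projector V (Vh h) (a h) (rh h)" "is_projector V (Vh_plus h) (a_plus h) (rh_plus h)"
      using projectors h by auto
    have bil: "bilinear_form_on V (a h)" "bilinear_form_on V (a_plus h)" using bilinear h by auto
    have sub: "subspace (Vh h)" "Vh h \<subseteq> V" "Vh_plus h \<subseteq> V"
      using fe_spaces h by (auto simp: finite_dim_subspace_def)
    have VhW: "Vh h \<subseteq> sobolev_space \<Omega> s \<eta>" "Vh_plus h \<subseteq> sobolev_space \<Omega> s \<eta>"
      using cond_i h by auto
    have uV: "u \<in> V" and uW: "u \<in> sobolev_space \<Omega> s \<eta>"
      using u sobolev_space_mono[of s r \<Omega> \<eta>] r by auto
    have ru: "rh h u \<in> Vh h" "rh_plus h u \<in> Vh_plus h"
      using proj uV by (auto simp: is_projector_def)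
    have dW: "rh h u - u \<in> sobolev_space \<Omega> s \<eta>" "rh_plus h u - u \<in> sobolev_space \<Omega> s \<eta>"
      using ru VhW uW by (auto intro!: sobolev_space_diff(1)[OF domain(1) \<eta>1])
    have dV: "rh h u - u \<in> V" using ru sub uV Vsub by (auto intro: subspace_diff)
    have eW: "e \<in> sobolev_space \<Omega> s \<eta>"
      using ru VhW by (auto simp: e_def intro!: sobolev_space_diff(1)[OF domain(1) \<eta>1])
    have "rh_plus h u + (- rh h u) \<in> Vh_plus h + Vh h"
      by (intro set_plus_intro ru subspace_neg[OF sub(1)])
    then have "e \<in> Vh_plus h + Vh h" by (simp add: e_def)
    then have w: "w \<in> Vh_plus h \<inter> Vh h" and w0: "N 0 \<eta> w \<le> C3 * N 0 \<eta> e"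
      and supp: "measure lebesgue (ess_support \<Omega> (e - w)) \<le> C3 * h powr \<gamma>"
      using C3(2)[OF h, of e] unfolding w_def ess_support_minus_commute[of \<Omega> e] by blast+
    have wW: "w \<in> sobolev_space \<Omega> s \<eta>" and wV: "w \<in> V"
      using w VhW sub by blast+
    have triangle: "N m \<eta> (f - g) \<le> 4 * K m * (N m \<eta> f + N m \<eta> g)"
      if "f \<in> sobolev_space \<Omega> s \<eta>" "g \<in> sobolev_space \<Omega> s \<eta>" "m \<le> s" for f g m
      using sobolev_space_diff(2)[OF domain(1) \<eta>1] sobolev_space_mono[OF that(3)] that
      unfolding N_def K_def by blast
    have eb: "N m \<eta> e \<le> 4 * K m * E * l h * h powr (real r - real m) * U u" if "m \<le> s" for m
    proof -
      have "e = (rh_plus h u - u) - (rh h u - u)" by (simp add: e_def)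
      then have "N m \<eta> e \<le> 4 * K m * (N m \<eta> (rh_plus h u - u) + N m \<eta> (rh h u - u))"
        using triangle[OF dW(2,1) that] by simp
      also have "\<dots> \<le> 4 * K m * (E * l h * h powr (real r - real m) * U u)"
        using err[OF h u that] K1[of m] by (intro mult_left_mono) auto
      finally show ?thesis by (simp add: mult.assoc)
    qed
    \<comment> \<open>The bound \<open>eb\<close> enters only at order 0, with rate h^r; the inverse
      estimate turns this into h^(r-m).\<close>
    have wb: "N m \<eta> w \<le> Dw * l h * h powr (real r - real m) * U u" if "m \<le> s" for m
    proof -
      have "N m \<eta> w \<le> C2 * h powr (- real m) * N 0 \<eta> w" by (rule C2(2)[OF h that w])
      also have "\<dots> \<le> C2 * h powr (- real m) * (C3 * (D0 * l h * h powr real r * U u))"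
      proof (rule mult_left_mono)
        have "C3 * N 0 \<eta> e \<le> C3 * (D0 * l h * h powr real r * U u)"
          using eb[of 0] C3(1) by (simp add: D0_def)
        with w0 show "N 0 \<eta> w \<le> C3 * (D0 * l h * h powr real r * U u)" by (rule order_trans)
      qed (use C2(1) in simp)
      also have "\<dots> = Dw * l h * (h powr (- real m) * h powr real r) * U u"
        by (simp add: Dw_def)
      also have "h powr (- real m) * h powr real r = h powr (real r - real m)"
        by (simp flip: powr_add)
      finally show ?thesis .
    qed
    have ewb: "N s \<eta> (e - w) \<le> Ds * l h * h powr (real r - real s) * U u"
    proof -
      have "N s \<eta> (e - w) \<le> 4 * K s * (N s \<eta> e + N s \<eta> w)" by (rule triangle[OF eW wW order_refl])
      also have "\<dots> \<le> 4 * K s * (4 * K s * E * l h * h powr (real r - real s) * U u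
          + Dw * l h * h powr (real r - real s) * U u)"
        using eb[of s] wb[of s] K1[of s] by (intro mult_left_mono add_mono) auto
      finally show ?thesis by (simp add: Ds_def algebra_simps)
    qed
    have ew2: "N s 2 (e - w) \<le> D2 * l h * h powr (real r - real s + \<gamma> * \<theta>) * U u"
    proof -
      let ?S = "ess_support \<Omega> (e - w)"
      have "e - w \<in> sobolev_space \<Omega> s \<eta>"
        by (rule sobolev_space_diff(1)[OF domain(1) \<eta>1 eW wW])
      then have "N s 2 (e - w) \<le> K s * (measure lebesgue ?S powr \<theta> * N s \<eta> (e - w))"
        using sobolev_norm_le_of_support[OF domain(1) _ \<eta> _ ess_support_lmeasurable[OF domain(1,2)]
            ess_support_subset order_refl]
        unfolding N_def K_def \<theta>_def half[symmetric] by simp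
      also have "\<dots> \<le> K s * ((C3 * h powr \<gamma>) powr \<theta> * (Ds * l h * h powr (real r - real s) * U u))"
        using supp \<theta>0 K1[of s] N0 ewb by (intro mult_left_mono mult_mono powr_mono2) auto
      also have "(C3 * h powr \<gamma>) powr \<theta> = C3 powr \<theta> * h powr (\<gamma> * \<theta>)"
        by (simp add: powr_mult powr_powr)
      also have "K s * (C3 powr \<theta> * h powr (\<gamma> * \<theta>) * (Ds * l h * h powr (real r - real s) * U u))
          = D2 * l h * (h powr (real r - real s) * h powr (\<gamma> * \<theta>)) * U u"
        by (simp add: D2_def)
      also have "h powr (real r - real s) * h powr (\<gamma> * \<theta>) = h powr (real r - real s + \<gamma> * \<theta>)"
        by (simp add: powr_add)
      finally show ?thesis .
    qed
    have "\<kappa> * (N s 2 e)\<^sup>2 \<le> M * N s 2 e * N s 2 (e - w) + Z"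
      using projector_difference_estimate[OF Vsub bil cc[OF h] proj sub(2,3) uV w]
      by (simp add: N_def e_def Z_def)
    also have "\<dots> \<le> M * N s 2 e * (D2 * l h * h powr (real r - real s + \<gamma> * \<theta>) * U u) + Z"
      using ew2 \<kappa>M N0 by (intro add_right_mono mult_left_mono) auto
    finally have 1: "\<kappa> * (N s 2 e)\<^sup>2 \<le> M * N s 2 e * (D2 * l h * h powr (real r - real s + \<gamma> * \<theta>) * U u) + Z" .
    have 2: "Z \<le> (sqrt D4 * l h * h powr (real r - real s + \<tau>) * U u)\<^sup>2"
    proof -
      \<comment> \<open>On the bounded set \<Omega> the exponent \<eta> is traded for q at the cost
        of the factor \<open>mq\<close>.\<close>
      have w\<nu>: "N \<nu> q w \<le> K \<nu> * mq * (Dw * l h * h powr (real r - real \<nu>) * U u)"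
      proof -
        have "w \<in> sobolev_space \<Omega> \<nu> \<eta>" using wW sobolev_space_mono[OF form_params(6)] by blast
        then have "N \<nu> q w \<le> K \<nu> * (mq * N \<nu> \<eta> w)"
          unfolding N_def K_def mq_def
          by (rule sobolev_norm_le_of_support[OF domain(1) form_params(3,4) _
              lmeasurable_open[OF domain(2,1)] order_refl ess_support_subset])
        also have "\<dots> \<le> K \<nu> * (mq * (Dw * l h * h powr (real r - real \<nu>) * U u))"
          using wb[OF form_params(6)] K1[of \<nu>] pos by (intro mult_left_mono) auto
        finally show ?thesis by (simp add: mult.assoc)
      qed
      have d\<mu>: "N \<mu> \<eta> (rh h u - u) \<le> E * l h * h powr (real r - real \<mu>) * U u"
        using err[OF h u form_params(5)] N0[of \<mu> \<eta> "rh_plus h u - u"] by linarith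
      have "Z \<le> \<bar>a_plus h (rh h u - u) w - a h (rh h u - u) w\<bar>" by (simp add: Z_def)
      also have "\<dots> \<le> C1 * h powr \<delta> * N \<mu> \<eta> (rh h u - u) * N \<nu> q w"
        using form_diff h dW dV wW wV unfolding N_def by blast
      also have "\<dots> \<le> C1 * h powr \<delta> * (E * l h * h powr (real r - real \<mu>) * U u)
          * (K \<nu> * mq * (Dw * l h * h powr (real r - real \<nu>) * U u))"
        using d\<mu> form_params(1) N0 w\<nu> E0 lp U0[of u] by (intro mult_mono mult_nonneg_nonneg) auto
      also have "\<dots> = D4 * (l h * U u)\<^sup>2 * (h powr \<delta> * h powr (real r - real \<mu>) * h powr (real r - real \<nu>))"
        by (simp add: D4_def power2_eq_square)
      \<comment> \<open>The exponents match because \<delta> + (r - \<mu>) + (r - \<nu>) = 2 (r - s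
        + \<tau>).\<close>
      also have "h powr \<delta> * h powr (real r - real \<mu>) * h powr (real r - real \<nu>)
          = (h powr (real r - real s + \<tau>))\<^sup>2"
        by (simp add: power2_eq_square \<tau>_def flip: powr_add)
      finally show ?thesis using pos by (simp add: power_mult_distrib mult_ac)
    qed
    have 3: "Z = 0" if "\<forall>h\<in>{0<..h0}. \<forall>v\<in>V. \<forall>w\<in>V. a h v w = a_plus h v w"
      using that h dV wV by (simp add: Z_def)
    show ?thesis using 1 2 3 unfolding e_def by blast
  qed
  have sqrt_pos: "0 < sqrt \<kappa>" using \<kappa>M by simp
  define \<sigma> where "\<sigma> = min (\<gamma> * \<theta>) \<tau>"
  define C\<theta> where "C\<theta> = M / \<kappa> * D2"
  define C\<tau> where "C\<tau> = sqrt D4 / sqrt \<kappa>"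
  have C0': "0 \<le> C\<theta>" "0 \<le> C\<tau>" using pos \<kappa>M by (simp_all add: C\<theta>_def C\<tau>_def)
  \<comment> \<open>The summand 1 makes the constant strictly positive, as \<open>C\<theta>\<close>
    and \<open>C\<tau>\<close> are only known to be nonnegative.\<close>
  have general: "N s 2 (rh_plus h u - rh h u)
      \<le> (C\<theta> * h0 powr (\<gamma> * \<theta> - \<sigma>) + C\<tau> * h0 powr (\<tau> - \<sigma>) + 1) * l h * h powr (real r - real s + \<sigma>) * U u"
    if h: "h \<in> {0<..h0}" and u: "u \<in> sobolev_space \<Omega> r \<eta> \<inter> V" for h u
  proof -
    define P where "P = l h * U u"
    have P: "0 \<le> P" using l0[OF h] U0[of u] by (simp add: P_def)
    have hh: "0 < h" "h \<le> h0" using h by auto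
    have "\<kappa> * (N s 2 (rh_plus h u - rh h u))\<^sup>2
        \<le> M * N s 2 (rh_plus h u - rh h u) * (D2 * l h * h powr (real r - real s + \<gamma> * \<theta>) * U u)
          + (sqrt D4 * l h * h powr (real r - real s + \<tau>) * U u)\<^sup>2"
      using core[OF h u] by (elim exE conjE) linarith
    then have "N s 2 (rh_plus h u - rh h u)
        \<le> M / \<kappa> * (D2 * l h * h powr (real r - real s + \<gamma> * \<theta>) * U u)
          + (sqrt D4 * l h * h powr (real r - real s + \<tau>) * U u) / sqrt \<kappa>"
      using \<kappa>M pos l0[OF h] U0[of u] by (intro quadratic_inequality_bound) auto
    also have "\<dots> = C\<theta> * P * h powr (real r - real s + \<gamma> * \<theta>) + C\<tau> * P * h powr (real r - real s + \<tau>)"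
      by (simp add: C\<theta>_def C\<tau>_def P_def mult_ac)
    also have "\<dots> \<le> C\<theta> * P * (h0 powr (\<gamma> * \<theta> - \<sigma>) * h powr (real r - real s + \<sigma>))
        + C\<tau> * P * (h0 powr (\<tau> - \<sigma>) * h powr (real r - real s + \<sigma>))"
      using P C0' powr_le_const_mult_powr[OF hh, of "real r - real s + \<sigma>" "real r - real s + \<gamma> * \<theta>"]
        powr_le_const_mult_powr[OF hh, of "real r - real s + \<sigma>" "real r - real s + \<tau>"]
      by (intro add_mono mult_left_mono) (auto simp: \<sigma>_def)
    also have "\<dots> \<le> C\<theta> * P * (h0 powr (\<gamma> * \<theta> - \<sigma>) * h powr (real r - real s + \<sigma>))
        + C\<tau> * P * (h0 powr (\<tau> - \<sigma>) * h powr (real r - real s + \<sigma>)) + P * h powr (real r - real s + \<sigma>)"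
      using P by simp
    finally show ?thesis by (simp add: P_def algebra_simps)
  qed
  have equal_forms: "N s 2 (rh_plus h u - rh h u) \<le> (C\<theta> + 1) * l h * h powr (real r - real s + \<gamma> * \<theta>) * U u"
    if eq: "\<forall>h\<in>{0<..h0}. \<forall>v\<in>V. \<forall>w\<in>V. a h v w = a_plus h v w"
      and h: "h \<in> {0<..h0}" and u: "u \<in> sobolev_space \<Omega> r \<eta> \<inter> V" for h u
  proof -
    define P where "P = l h * h powr (real r - real s + \<gamma> * \<theta>) * U u"
    have P: "0 \<le> P" using l0[OF h] U0[of u] by (simp add: P_def)
    \<comment> \<open>With \<open>Z\<close> equal to 0 the quadratic inequality applies with Y = 0,
      so only the support exponent survives.\<close>
    have "\<kappa> * (N s 2 (rh_plus h u - rh h u))\<^sup>2 \<le> M * N s 2 (rh_plus h u - rh h u) * (D2 * P) + 0\<^sup>2"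
      using core[OF h u] eq by (elim exE conjE) (simp add: P_def mult.assoc)
    then have "N s 2 (rh_plus h u - rh h u) \<le> M / \<kappa> * (D2 * P) + 0 / sqrt \<kappa>"
      using \<kappa>M pos P by (intro quadratic_inequality_bound) auto
    also have "\<dots> \<le> (C\<theta> + 1) * P" using P by (simp add: C\<theta>_def algebra_simps)
    finally show ?thesis by (simp add: P_def mult.assoc)
  qed
  show ?thesis
  proof (intro conjI impI)
    have "0 < C\<theta> * h0 powr (\<gamma> * \<theta> - \<sigma>) + C\<tau> * h0 powr (\<tau> - \<sigma>) + 1"
      using C0' by (simp add: add_nonneg_pos)
    then show "\<exists>C>0. \<forall>h\<in>{0<..h0}. \<forall>u \<in> sobolev_space \<Omega> r \<eta> \<inter> V.
        sobolev_norm \<Omega> s 2 (rh_plus h u - rh h u)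
          \<le> C * l h * h powr (real r - real s +
                min (\<gamma> * (1/2 - enn2real (1 / \<eta>)))
                    ((\<delta> + 2 * real s - real \<mu> - real \<nu>) / 2))
            * sobolev_seminorm \<Omega> r \<eta> u"
      using general unfolding N_def U_def \<sigma>_def \<theta>_def \<tau>_def by blast
  next
    assume "\<forall>h\<in>{0<..h0}. \<forall>v\<in>V. \<forall>w\<in>V. a h v w = a_plus h v w"
    moreover have "0 < C\<theta> + 1" using C0' by simp
    ultimately show "\<exists>C>0. \<forall>h\<in>{0<..h0}. \<forall>u \<in> sobolev_space \<Omega> r \<eta> \<inter> V.
        sobolev_norm \<Omega> s 2 (rh_plus h u - rh h u)
          \<le> C * l h * h powr (real r - real s + \<gamma> * (1/2 - enn2real (1 / \<eta>)))
            * sobolev_seminorm \<Omega> r \<eta> u"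
      using equal_forms unfolding N_def U_def \<theta>_def by blast
  qed
qed

end
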